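(* Let $n\ge 1$, let $p \ge 2$ be real and let $s$ be an integer with $0 \le s \le \frac n2$. Then for every nonzero homogeneous polynomial $f$ of degree $s$ on $\{0,1\}^n$, \[ \frac{\mathbb{E} |f|^p}{\left(\mathbb{E} f^2\right)^{\frac p2}} ~\le~ 2^{\psi\left(p,\frac sn\right) \cdot n}. \] Moreover, there is an absolute constant $C > 0$ such that for all $n\ge 1$, all $p \ge 2$ and all integers $1 \le s \le \frac n2$, \[ 2^{\psi\left(p,\frac sn\right) \cdot n} ~\le~ n \cdot C^p \cdot s^{\frac p4} \cdot \frac{\mathbb{E} |K_s|^p}{\left(\mathbb{E} K_s^2\right)^{\frac p2}}. \]
   Context: $\{0,1\}^n$ carries the uniform probability measure; $\mathbb{E}$ denotes expectation with respect to it. For $\alpha\in\{0,1\}^n$ the Walsh–Fourier character is $W_\alpha(y)=(-1)^{\sum_i \alpha_i y_i}$, and $|\alpha|$ is the Hamming weight. A homogeneous polynomial of degree $s$ on $\{0,1\}^n$ is a real linear combination of the $W_\alpha$ with $|\alpha|=s$. The Krawchouk polynomial is $K_s=\sum_{|\alpha|=s}W_\alpha$, i.e. $K_s(x)=\sum_{S\subseteq[n],|S|=s}(-1)^{\sum_{i\in S}x_i}$. $H(t)=-t\log_2 t-(1-t)\log_2(1-t)$ is the binary entropy function. For $0\le u\le \frac12$ and $0<v\le \frac12-\sqrt{u(1-u)}$ let $I(u,v)=\log_2(1-u)+\frac a2\log_2(1-2u-b)+u\log_2\frac{a+b}{2(1-u)}-\frac12\log_2\left(2(1-u)-a^2-ab\right)$,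 where $a=1-2v$, $b=\sqrt{a^2-4u(1-u)}$; and set $I(u,0)=-1$ for $0\le u\le\frac12$. For $0\le x,y\le\frac12$ let $\tau(x,y)=H(x)+I(y,x)-I(0,x)$ if $y\le \frac12-\sqrt{x(1-x)}$, and $\tau(x,y)=\frac{1+H(x)-H(y)}{2}$ otherwise. For $p\ge 2$ and $0\le x\le\frac12$ let $h(p,x)=x^{1/p}(1-x)^{(p-1)/p}+x^{(p-1)/p}(1-x)^{1/p}$ (for fixed $p$ this is a continuous strictly increasing bijection from $[0,\frac12]$ onto $[0,1]$), and define $\psi(p,x)=H(y)-1+p\,\tau(x,y)-\frac p2H(x)$, where $y\in[0,\frac12]$ is determined by $h(p,y)=1-2x$. *)

theory Defs
  imports "HOL-Probability.Probability"
begin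

definition cube :: "nat \<Rightarrow> (nat \<Rightarrow> nat) set" where
  "cube n = {..<n} \<rightarrow>\<^sub>E {0, 1}"

definition cube_expectation :: "nat \<Rightarrow> ((nat \<Rightarrow> nat) \<Rightarrow> real) \<Rightarrow> real" where
  "cube_expectation n g = measure_pmf.expectation (pmf_of_set (cube n)) g"

definition hamming_weight :: "nat \<Rightarrow> (nat \<Rightarrow> nat) \<Rightarrow> nat" where
  "hamming_weight n \<alpha> = card {i \<in> {..<n}. \<alpha> i \<noteq> 0}"

definition walsh :: "nat \<Rightarrow> (nat \<Rightarrow> nat) \<Rightarrow> (nat \<Rightarrow> nat) \<Rightarrow> real" where
  "walsh n \<alpha> y = (- 1) ^ (\<Sum>i<n. \<alpha> i * y i)"

definition homogeneous_poly :: "nat \<Rightarrow> nat \<Rightarrow> ((nat \<Rightarrow> nat) \<Rightarrow> real) \<Rightarrow> bool" where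
  "homogeneous_poly n s f \<longleftrightarrow>
     (\<exists>c :: (nat \<Rightarrow> nat) \<Rightarrow> real. \<forall>x \<in> cube n.
        f x = (\<Sum>\<alpha> \<in> {\<alpha> \<in> cube n. hamming_weight n \<alpha> = s}. c \<alpha> * walsh n \<alpha> x))"

definition krawchouk :: "nat \<Rightarrow> nat \<Rightarrow> (nat \<Rightarrow> nat) \<Rightarrow> real" where
  "krawchouk n s x = (\<Sum>\<alpha> \<in> {\<alpha> \<in> cube n. hamming_weight n \<alpha> = s}. walsh n \<alpha> x)"

text \<open>The convention \<open>0 log 0 = 0\<close> holds below because \<open>0 * z = 0\<close>.\<close>

definition binary_entropy :: "real \<Rightarrow> real" where
  "binary_entropy t = - t * log 2 t - (1 - t) * log 2 (1 - t)"

text \<open>Meaningful for \<open>0 \<le> u \<le> 1/2\<close> and \<open>0 \<le> v \<le> 1/2 - sqrt (u (1 - u))\<close>. For \<open>v > 0\<close>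
  in this range all arguments of \<open>log 2\<close> are positive, except that \<open>a + b = 0\<close> for
  \<open>u = 0\<close>, \<open>v = 1/2\<close>, where the factor \<open>u\<close> makes the term vanish.\<close>

definition I_fun :: "real \<Rightarrow> real \<Rightarrow> real" where
  "I_fun u v =
     (if v = 0 then - 1
      else let a = 1 - 2 * v; b = sqrt (a\<^sup>2 - 4 * u * (1 - u)) in
        log 2 (1 - u) + a / 2 * log 2 (1 - 2 * u - b)
        + u * log 2 ((a + b) / (2 * (1 - u)))
        - 1 / 2 * log 2 (2 * (1 - u) - a\<^sup>2 - a * b))"

definition tau :: "real \<Rightarrow> real \<Rightarrow> real" where
  "tau x y =
     (if y \<le> 1 / 2 - sqrt (x * (1 - x))
      then binary_entropy x + I_fun y x - I_fun 0 x
      else (1 + binary_entropy x - binary_entropy y) / 2)"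

definition h_fun :: "real \<Rightarrow> real \<Rightarrow> real" where
  "h_fun p x = x powr (1 / p) * (1 - x) powr ((p - 1) / p)
             + x powr ((p - 1) / p) * (1 - x) powr (1 / p)"

text \<open>For \<open>p \<ge> 2\<close> the map \<open>h_fun p\<close> is a bijection from \<open>[0, 1/2]\<close> onto \<open>[0, 1]\<close>, so the
  definite description is proper whenever \<open>0 \<le> x \<le> 1/2\<close>.\<close>

definition psi :: "real \<Rightarrow> real \<Rightarrow> real" where
  "psi p x =
     (let y = (THE y. 0 \<le> y \<and> y \<le> 1 / 2 \<and> h_fun p y = 1 - 2 * x) in
        binary_entropy y - 1 + p * tau x y - p / 2 * binary_entropy x)"

end

theory Submission
  imports Defs
begin

text \<open>
  Let \<open>T\<close> multiply the coefficient of \<open>W\<^sub>\<alpha>\<close> by \<open>w ^ |\<alpha>|\<close>. On homogeneous polynomials of degree \<open>s\<close> it is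
  multiplication by \<open>w ^ s\<close>, and its norm from \<open>L\<^sub>2\<close> to \<open>L\<^sub>p\<close> is the \<open>n\<close>-th power of the norm for
  \<open>n = 1\<close>. This bounds the moment ratio for every \<open>w\<close>. The best \<open>w\<close> is obtained by parametrising
  \<open>h(p, y) = 1 - 2 x\<close> by the saddle point \<open>z\<close> of \<open>(1 + z) ^ (1 - y) * (1 - z) ^ y / z ^ x\<close>; for it the
  bound is exactly \<open>2 ^ (\<psi> n)\<close>, because the critical value of this function is \<open>2 ^ \<tau>(x, y)\<close>.

  Conversely, let \<open>G = \<Sum>\<^sub>j z ^ j K\<^sub>j\<close>. Testing \<open>K\<^sub>s\<close> against \<open>G ^ (p - 1)\<close>, which is again a multiple of a
  generating function \<open>\<Sum>\<^sub>j u ^ j K\<^sub>j\<close>, loses only the factor \<open>P(Bin(n, s / n) = s)\<close> relative to the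
  upper bound, since \<open>z u = x / (1 - x)\<close>; this probability is at least of order \<open>1 / sqrt s\<close>.
\<close>

section \<open>The two-point inequality\<close>

text \<open>For a uniform random sign e, \<open>psum r v / 2\<close> is the expectation of
  \<open>(1 + v * e) powr r\<close>, and \<open>pdiff r v / 2\<close> below is that of e times the
  same power.\<close>

definition psum :: "real \<Rightarrow> real \<Rightarrow> real" where
  "psum r v = (1 + v) powr r + (1 - v) powr r"

definition pdiff :: "real \<Rightarrow> real \<Rightarrow> real" where
  "pdiff r v = (1 + v) powr r - (1 - v) powr r"

lemma powr_minus_one_mult: "x \<ge> 0 \<Longrightarrow> x powr (p - 1) * x = x powr (p::real)" for x :: real
  using powr_add[of x "p - 1" 1] by simp

lemma psum_pos: "0 \<le> v \<Longrightarrow> 0 < psum r v"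
  unfolding psum_def by (simp add: add_pos_nonneg)

lemma pdiff_pos: "r > 0 \<Longrightarrow> 0 < v \<Longrightarrow> v \<le> 1 \<Longrightarrow> 0 < pdiff r v"
  unfolding pdiff_def by (simp add: powr_less_mono2)

lemma pdiff_nonneg: "r > 0 \<Longrightarrow> 0 \<le> v \<Longrightarrow> v \<le> 1 \<Longrightarrow> 0 \<le> pdiff r v"
  unfolding pdiff_def by (simp add: powr_mono2)

lemma psum_rec:
  assumes "0 \<le> v" "v \<le> 1"
  shows "psum p v = psum (p - 1) v + v * pdiff (p - 1) v"
  using powr_minus_one_mult[of "1 + v" p] powr_minus_one_mult[of "1 - v" p] assms
  unfolding psum_def pdiff_def by (simp add: algebra_simps)

lemma continuous_on_psum: "r > 0 \<Longrightarrow> A \<subseteq> {0..1} \<Longrightarrow> continuous_on A (psum r)"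
  unfolding psum_def by (intro continuous_intros continuous_on_powr') auto

lemma continuous_on_pdiff: "r > 0 \<Longrightarrow> A \<subseteq> {0..1} \<Longrightarrow> continuous_on A (pdiff r)"
  unfolding pdiff_def by (intro continuous_intros continuous_on_powr') auto

lemma DERIV_psum:
  assumes "0 \<le> v" "v < 1"
  shows "(psum r has_real_derivative r * pdiff (r - 1) v) (at v)"
  unfolding psum_def pdiff_def
  by (rule derivative_eq_intros refl | use assms in \<open>force simp: algebra_simps\<close>)+

lemma DERIV_pdiff:
  assumes "0 \<le> v" "v < 1"
  shows "(pdiff r has_real_derivative r * psum (r - 1) v) (at v)"
  unfolding psum_def pdiff_def
  by (rule derivative_eq_intros refl | use assms in \<open>force simp: algebra_simps\<close>)+

text \<open>The numerator of the derivative of \<open>pdiff r / psum r\<close>, up to the factor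
  \<open>r\<close>. The pure powers cancel and only products of a power of \<open>1 + v\<close> with
  one of \<open>1 - v\<close> remain.\<close>

lemma psum_mult_minus_pdiff_mult:
  assumes "0 \<le> v" "v < 1"
  shows "psum (r - 1) v * psum r v - pdiff (r - 1) v * pdiff r v = 4 * (1 - v\<^sup>2) powr (r - 1)"
proof -
  define P Q where "P = (1 + v) powr (r - 1)" and "Q = (1 - v) powr (r - 1)"
  have 1: "(1 + v) powr r = P * (1 + v)" "(1 - v) powr r = Q * (1 - v)"
    unfolding P_def Q_def using assms by (simp_all add: powr_minus_one_mult)
  have "(1 - v\<^sup>2) powr (r - 1) = P * Q"
    unfolding P_def Q_def using assms
    by (subst powr_mult[symmetric]) (auto simp: power2_eq_square algebra_simps)
  then show ?thesis
    unfolding psum_def pdiff_def 1 P_def[symmetric] Q_def[symmetric]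
    by (simp add: algebra_simps)
qed

lemma DERIV_pdiff_over_psum:
  assumes "0 \<le> v" "v < 1"
  shows "((\<lambda>v. pdiff r v / psum r v) has_real_derivative
           r * (4 * (1 - v\<^sup>2) powr (r - 1)) / (psum r v)\<^sup>2) (at v)"
  using DERIV_divide[OF DERIV_pdiff[OF assms, of r] DERIV_psum[OF assms, of r]] psum_pos[of v r] assms
  unfolding psum_mult_minus_pdiff_mult[OF assms, symmetric]
  by (simp add: power2_eq_square algebra_simps)

lemma psum_mono:
  assumes "r \<ge> 1" "0 \<le> v" "v \<le> v'" "v' < 1"
  shows "psum r v \<le> psum r v'"
proof (rule DERIV_nonneg_imp_nondecreasing[OF assms(3)])
  fix t assume t: "v \<le> t" "t \<le> v'"
  have "0 \<le> pdiff (r - 1) t"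
    unfolding pdiff_def using t assms by (simp add: powr_mono2)
  then show "\<exists>y. DERIV (psum r) t :> y \<and> 0 \<le> y"
    using DERIV_psum[of t r] t assms by (intro exI[of _ "r * pdiff (r - 1) t"]) auto
qed

text \<open>The function \<open>pdiff r / psum r\<close> is concave on \<open>[0, 1]\<close> and vanishes at \<open>0\<close>.\<close>

lemma pdiff_over_psum_star:
  assumes r: "r \<ge> 1" and v: "0 < v" "v \<le> v'" "v' \<le> 1"
  shows "v * (pdiff r v' / psum r v') \<le> v' * (pdiff r v / psum r v)"
proof (cases "v = v'")
  case False
  define u where "u v = pdiff r v / psum r v" for v
  define u' where "u' v = r * (4 * (1 - v\<^sup>2) powr (r - 1)) / (psum r v)\<^sup>2" for v
  have cont: "continuous_on A u" if "A \<subseteq> {0..1}" for A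
    unfolding u_def using that r
    by (intro continuous_intros continuous_on_psum continuous_on_pdiff) (auto dest!: subsetD simp: psum_pos less_imp_neq[symmetric])
  have mvt: "\<exists>t. a < t \<and> t < b \<and> u b - u a = (b - a) * u' t" if "0 \<le> a" "a < b" "b \<le> 1" for a b
  proof -
    have D: "DERIV u t :> u' t" if "a < t" "t < b" for t
      unfolding u_def u'_def using that \<open>0 \<le> a\<close> \<open>b \<le> 1\<close> by (intro DERIV_pdiff_over_psum) auto
    have "\<exists>l t. a < t \<and> t < b \<and> DERIV u t :> l \<and> u b - u a = (b - a) * l"
    proof (rule MVT[OF \<open>a < b\<close>])
      show "continuous_on {a..b} u" using that by (intro cont) auto
      show "u differentiable (at t)" if "a < t" "t < b" for t
        using D[OF that] real_differentiable_def by blast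
    qed
    then show ?thesis using D DERIV_unique by blast
  qed
  have u0: "u 0 = 0" by (simp add: u_def pdiff_def)
  obtain t where t: "0 < t" "t < v" "u v = v * u' t"
    using mvt[of 0 v] v u0 by auto
  obtain t' where t': "v < t'" "t' < v'" "u v' - u v = (v' - v) * u' t'"
    using mvt[of v v'] v False by auto
  \<comment> \<open>The numerator of the derivative falls because \<open>r \<ge> 1\<close>, while
    \<open>psum r\<close> grows. So the slope over \<open>[v, v']\<close> is at most the slope over
    \<open>[0, v]\<close>.\<close>
  have "u' t' \<le> u' t"
    unfolding u'_def
  proof (rule frac_le)
    show "r * (4 * (1 - t'\<^sup>2) powr (r - 1)) \<le> r * (4 * (1 - t\<^sup>2) powr (r - 1))"
      using t t' v r by (intro mult_left_mono powr_mono2) (auto simp: power_mono abs_square_le_1 power_le_one)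
    show "(psum r t)\<^sup>2 \<le> (psum r t')\<^sup>2"
      using t t' v r psum_pos[of t r] by (intro power_mono psum_mono) auto
  qed (use t r psum_pos[of t r] in auto)
  then have "v * ((v' - v) * u' t') \<le> v * ((v' - v) * u' t)"
    using v by (intro mult_left_mono) auto
  then have "v * (u v' - u v) \<le> (v' - v) * (v * u' t)"
    unfolding t' by (simp add: algebra_simps)
  also have "v * u' t = u v" using t by simp
  finally have "v * u v' \<le> v' * u v" by (simp add: algebra_simps)
  then show ?thesis unfolding u_def .
qed auto

text \<open>The point \<open>z\<close> maximises \<open>psum p v / (w^2 + v^2) powr (p / 2)\<close>
  over the unit interval: \<open>wz\<close> makes it critical, and by
  \<open>pdiff_over_psum_star\<close> the logarithmic derivative is nonnegative before it and
  nonpositive after it.\<close>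

lemma two_point_tangent:
  assumes p: "p \<ge> 2" and z: "0 < z" "z \<le> 1" and w: "w > 0"
    and wz: "w\<^sup>2 * pdiff (p - 1) z = z * psum (p - 1) z" and v: "0 \<le> v" "v \<le> 1"
  shows "psum p v * (w\<^sup>2 + z\<^sup>2) powr (p / 2) \<le> psum p z * (w\<^sup>2 + v\<^sup>2) powr (p / 2)"
proof -
  define \<phi> where "\<phi> v = ln (psum p v) - p / 2 * ln (w\<^sup>2 + v\<^sup>2)" for v
  have pos: "w\<^sup>2 + t\<^sup>2 > 0" for t using w by (simp add: add_pos_nonneg)
  have cont: "continuous_on A \<phi>" if "A \<subseteq> {0..1}" for A
  proof -
    have "continuous_on A (psum p)" using that p by (intro continuous_on_psum) auto
    moreover have "\<forall>t\<in>A. psum p t \<noteq> 0" using that psum_pos[of _ p] by (metis atLeastAtMost_iff less_irrefl subsetD)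
    moreover have "continuous_on A (\<lambda>t. w\<^sup>2 + t\<^sup>2)" by (intro continuous_intros)
    moreover have "\<forall>t\<in>A. w\<^sup>2 + t\<^sup>2 \<noteq> 0" using pos by (metis less_irrefl)
    ultimately show ?thesis
      unfolding \<phi>_def by (intro continuous_on_diff continuous_on_mult continuous_on_const continuous_on_ln)
  qed
  \<comment> \<open>The numerator is already simplified by \<open>psum_rec\<close>; its sign
    compares \<open>pdiff (p - 1) t / psum (p - 1) t\<close> with \<open>t / w^2\<close>.\<close>
  define \<phi>' where "\<phi>' t = p * (w\<^sup>2 * pdiff (p - 1) t - t * psum (p - 1) t) / (psum p t * (w\<^sup>2 + t\<^sup>2))" for t
  have D: "DERIV \<phi> t :> \<phi>' t" if "0 < t" "t < 1" for t
  proof -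
    have rec: "psum p t = psum (p - 1) t + t * pdiff (p - 1) t" using that by (intro psum_rec) auto
    have ps: "psum p t > 0" using psum_pos that by auto
    have "DERIV (\<lambda>v. ln (psum p v)) t :> 1 / psum p t * (p * pdiff (p - 1) t)"
      using that by (intro DERIV_chain2[OF DERIV_ln_divide[OF ps] DERIV_psum]) auto
    moreover have "DERIV (\<lambda>v. p / 2 * ln (w\<^sup>2 + v\<^sup>2)) t :> p / 2 * (1 / (w\<^sup>2 + t\<^sup>2) * (2 * t))"
      using pos[of t]
      by (intro DERIV_cmult DERIV_chain2[OF DERIV_ln_divide]) (auto intro!: derivative_eq_intros)
    ultimately have "DERIV \<phi> t :> 1 / psum p t * (p * pdiff (p - 1) t) - p / 2 * (1 / (w\<^sup>2 + t\<^sup>2) * (2 * t))"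
      unfolding \<phi>_def by (rule DERIV_diff)
    also have "1 / psum p t * (p * pdiff (p - 1) t) - p / 2 * (1 / (w\<^sup>2 + t\<^sup>2) * (2 * t))
      = p * (pdiff (p - 1) t * (w\<^sup>2 + t\<^sup>2) - t * psum p t) / (psum p t * (w\<^sup>2 + t\<^sup>2))"
      using ps less_imp_neq[OF pos[of t]] by (simp add: diff_frac_eq right_diff_distrib mult_ac)
    also have "\<dots> = \<phi>' t" unfolding \<phi>'_def
      by (simp add: rec algebra_simps power2_eq_square)
    finally show ?thesis .
  qed
  have Sz: "psum (p - 1) z > 0" and Nz: "pdiff (p - 1) z > 0"
    using psum_pos pdiff_pos[of "p - 1" z] z p by auto
  have w2: "w\<^sup>2 = z * psum (p - 1) z / pdiff (p - 1) z" using wz Nz by (simp add: field_simps)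
  have sgn1: "\<phi>' t \<ge> 0" if "0 < t" "t \<le> z" for t
  proof -
    have "t * psum (p - 1) t \<le> w\<^sup>2 * pdiff (p - 1) t"
      using pdiff_over_psum_star[of "p - 1" t z] that z p psum_pos[of t "p - 1"] Sz Nz
      unfolding w2 by (simp add: field_simps)
    then show ?thesis unfolding \<phi>'_def using that p pos[of t] psum_pos[of t p]
      by (intro divide_nonneg_pos mult_nonneg_nonneg mult_pos_pos) auto
  qed
  have sgn2: "\<phi>' t \<le> 0" if "z \<le> t" "t \<le> 1" for t
  proof -
    have "t * psum (p - 1) t \<ge> w\<^sup>2 * pdiff (p - 1) t"
      using pdiff_over_psum_star[of "p - 1" z t] that z p psum_pos[of t "p - 1"] Sz Nz
      unfolding w2 by (simp add: field_simps)
    then show ?thesis unfolding \<phi>'_def using that p pos[of t] psum_pos[of t p] z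
      by (intro divide_nonpos_pos mult_nonneg_nonpos mult_pos_pos) auto
  qed
  have "\<phi> v \<le> \<phi> z"
  proof (cases "v \<le> z")
    case True
    show ?thesis
      by (rule DERIV_nonneg_imp_increasing_open[OF True])
        (use v z in \<open>auto intro!: exI[of _ "\<phi>' _"] D sgn1 cont\<close>)
  next
    case False
    then have "z \<le> v" by simp
    then show ?thesis
      by (rule DERIV_nonpos_imp_decreasing_open)
        (use v z in \<open>auto intro!: exI[of _ "\<phi>' _"] D sgn2 cont\<close>)
  qed
  then have "ln (psum p v) + p / 2 * ln (w\<^sup>2 + z\<^sup>2) \<le> ln (psum p z) + p / 2 * ln (w\<^sup>2 + v\<^sup>2)"
    unfolding \<phi>_def by simp
  then have "ln (psum p v * (w\<^sup>2 + z\<^sup>2) powr (p / 2)) \<le> ln (psum p z * (w\<^sup>2 + v\<^sup>2) powr (p / 2))"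
    using psum_pos[of v p] psum_pos[of z p] v z less_imp_neq[OF pos[of z]] less_imp_neq[OF pos[of v]]
    by (simp add: ln_mult ln_powr)
  moreover have "psum p t * (w\<^sup>2 + t'\<^sup>2) powr (p / 2) > 0" if "0 \<le> t" for t t'
    using psum_pos[OF that, of p] less_imp_neq[OF pos[of t']] by simp
  ultimately show ?thesis using v z by simp
qed

section \<open>The two-point inequality for arbitrary real pairs\<close>

lemma two_point_sum_abs:
  assumes "\<bar>b\<bar> \<le> a" "a > 0"
  shows "\<bar>a + b\<bar> powr p + \<bar>a - b\<bar> powr p = a powr p * psum p (\<bar>b\<bar> / a)"
proof -
  have "a powr p * psum p (\<bar>b\<bar> / a) = (a + \<bar>b\<bar>) powr p + (a - \<bar>b\<bar>) powr p"
    using assms unfolding psum_def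
    by (simp add: distrib_left powr_mult[symmetric] right_diff_distrib)
  then show ?thesis using assms by (cases "b \<ge> 0") auto
qed

text \<open>Once the common factor \<open>(1 - z) * (1 + z)\<close> is taken out, this is
  monotonicity of \<open>t powr (p - 2)\<close>, which is where \<open>p \<ge> 2\<close>
  enters.\<close>

lemma mixed_powr_le:
  assumes z: "0 \<le> z" "z \<le> 1" and p: "p \<ge> (2::real)"
  shows "(1 - z) powr (p - 1) * (1 + z) \<le> (1 + z) powr (p - 1) * (1 - z)"
proof -
  have "(1 - z) powr (p - 2) * ((1 - z) * (1 + z)) \<le> (1 + z) powr (p - 2) * ((1 - z) * (1 + z))"
    using z p by (intro mult_right_mono powr_mono2) auto
  moreover have "(1 - z) powr (p - 1) = (1 - z) powr (p - 2) * (1 - z)"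
    "(1 + z) powr (p - 1) = (1 + z) powr (p - 2) * (1 + z)"
    using powr_minus_one_mult[of "1 - z" "p - 1"] powr_minus_one_mult[of "1 + z" "p - 1"] z by simp_all
  ultimately show ?thesis by (simp only: mult_ac)
qed

text \<open>By homogeneity, the case \<open>|w * b| \<le> |a|\<close> is
  \<open>two_point_tangent\<close> at \<open>v = |w * b| / |a|\<close>. Otherwise \<open>a\<close>
  and \<open>w * b\<close> exchange roles, which is harmless because \<open>w \<le> 1\<close>.
  Equality holds at \<open>w * b = z * a\<close>.\<close>

lemma two_point_hypercontractive:
  fixes a b :: real
  assumes p: "p \<ge> 2" and z: "0 < z" "z \<le> 1" and w: "0 < w"
    and wz: "w\<^sup>2 * pdiff (p - 1) z = z * psum (p - 1) z"
  shows "\<bar>a + w * b\<bar> powr p + \<bar>a - w * b\<bar> powr p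
    \<le> psum p z * (w\<^sup>2 / (w\<^sup>2 + z\<^sup>2)) powr (p / 2) * (a\<^sup>2 + b\<^sup>2) powr (p / 2)"
proof -
  define K where "K = psum p z * (w\<^sup>2 / (w\<^sup>2 + z\<^sup>2)) powr (p / 2)"
  have K0: "K > 0" unfolding K_def using w z psum_pos[of z p] by (simp add: add_pos_nonneg)
  have wpos: "w\<^sup>2 + t\<^sup>2 > 0" for t using w by (simp add: add_pos_nonneg)
  have "z * psum (p - 1) z \<le> pdiff (p - 1) z"
    using mixed_powr_le[of z p] z p unfolding psum_def pdiff_def by (simp add: algebra_simps)
  then have "w\<^sup>2 * pdiff (p - 1) z \<le> 1 * pdiff (p - 1) z" unfolding wz by simp
  then have w1: "w\<^sup>2 \<le> 1"
    using pdiff_pos[of "p - 1" z] z p by (simp only: mult_le_cancel_right_pos)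
  have base: "psum p v \<le> K * (1 + v\<^sup>2 / w\<^sup>2) powr (p / 2)" if "0 \<le> v" "v \<le> 1" for v
  proof -
    have "psum p v \<le> psum p z * ((w\<^sup>2 + v\<^sup>2) powr (p / 2) / (w\<^sup>2 + z\<^sup>2) powr (p / 2))"
      using two_point_tangent[OF p z w wz that] wpos[of z] w
      unfolding times_divide_eq_right by (subst pos_le_divide_eq) auto
    also have "(w\<^sup>2 + v\<^sup>2) powr (p / 2) / (w\<^sup>2 + z\<^sup>2) powr (p / 2)
        = (w\<^sup>2 / (w\<^sup>2 + z\<^sup>2) * (1 + v\<^sup>2 / w\<^sup>2)) powr (p / 2)"
    proof -
      have "w\<^sup>2 * (1 + v\<^sup>2 / w\<^sup>2) = w\<^sup>2 + v\<^sup>2" using w by (simp add: field_simps)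
      then show ?thesis using wpos[of z] wpos[of v] by (simp add: powr_divide)
    qed
    also have "\<dots> = (w\<^sup>2 / (w\<^sup>2 + z\<^sup>2)) powr (p / 2) * (1 + v\<^sup>2 / w\<^sup>2) powr (p / 2)"
      by (intro powr_mult)
    finally show ?thesis unfolding K_def by simp
  qed
  have sq: "t powr p = (t\<^sup>2) powr (p / 2)" if "t > 0" for t :: real
    using that by (simp add: powr_powr flip: powr_numeral)
  have scaled: "\<bar>c + d\<bar> powr p + \<bar>c - d\<bar> powr p \<le> K * (c\<^sup>2 + d\<^sup>2 / w\<^sup>2) powr (p / 2)"
    if "\<bar>d\<bar> \<le> c" "c > 0" for c d
  proof -
    have "\<bar>c + d\<bar> powr p + \<bar>c - d\<bar> powr p = c powr p * psum p (\<bar>d\<bar> / c)"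
      using that by (intro two_point_sum_abs) auto
    also have "\<dots> \<le> c powr p * (K * (1 + (\<bar>d\<bar> / c)\<^sup>2 / w\<^sup>2) powr (p / 2))"
      using that by (intro mult_left_mono base) auto
    also have "\<dots> = K * (c\<^sup>2 * (1 + (\<bar>d\<bar> / c)\<^sup>2 / w\<^sup>2)) powr (p / 2)"
      using that by (subst powr_mult) (auto simp: sq)
    also have "c\<^sup>2 * (1 + (\<bar>d\<bar> / c)\<^sup>2 / w\<^sup>2) = c\<^sup>2 + d\<^sup>2 / w\<^sup>2"
      using that w by (simp add: field_simps)
    finally show ?thesis .
  qed
  show ?thesis
    unfolding K_def[symmetric]
  proof (cases "\<bar>w * b\<bar> \<le> \<bar>a\<bar>")
    case True
    show "\<bar>a + w * b\<bar> powr p + \<bar>a - w * b\<bar> powr p \<le> K * (a\<^sup>2 + b\<^sup>2) powr (p / 2)"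
    proof (cases "a = 0")
      case True
      with \<open>\<bar>w * b\<bar> \<le> \<bar>a\<bar>\<close> w show ?thesis by simp
    next
      case False
      have "\<bar>a + w * b\<bar> powr p + \<bar>a - w * b\<bar> powr p
          = \<bar>\<bar>a\<bar> + w * b\<bar> powr p + \<bar>\<bar>a\<bar> - w * b\<bar> powr p"
        using abs_minus_cancel[of "a + w * b"] abs_minus_cancel[of "a - w * b"]
        by (cases "a \<ge> 0") (auto simp: algebra_simps simp del: abs_minus_cancel)
      also have "\<dots> \<le> K * (\<bar>a\<bar>\<^sup>2 + (w * b)\<^sup>2 / w\<^sup>2) powr (p / 2)"
        using True False by (intro scaled) auto
      finally show ?thesis using w by (simp add: power_mult_distrib)
    qed
  next
    case False
    then have less: "a\<^sup>2 \<le> w\<^sup>2 * b\<^sup>2"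
      by (metis abs_le_square_iff linear power_mult_distrib)
    have "\<bar>a + w * b\<bar> powr p + \<bar>a - w * b\<bar> powr p
        = \<bar>\<bar>w * b\<bar> + a\<bar> powr p + \<bar>\<bar>w * b\<bar> - a\<bar> powr p"
    proof -
      have "\<bar>a + c\<bar> = \<bar>\<bar>c\<bar> + a\<bar> \<and> \<bar>a - c\<bar> = \<bar>\<bar>c\<bar> - a\<bar> \<or>
        \<bar>a + c\<bar> = \<bar>\<bar>c\<bar> - a\<bar> \<and> \<bar>a - c\<bar> = \<bar>\<bar>c\<bar> + a\<bar>" for c :: real by arith
      from this[of "w * b"] show ?thesis by auto
    qed
    also have "\<dots> \<le> K * (\<bar>w * b\<bar>\<^sup>2 + a\<^sup>2 / w\<^sup>2) powr (p / 2)"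
      using False by (intro scaled) auto
    also have "\<dots> \<le> K * (a\<^sup>2 + b\<^sup>2) powr (p / 2)"
    proof -
      \<comment> \<open>Up to the factor \<open>w^2\<close>, this product is the difference of the
        two sides below.\<close>
      have "0 \<le> (1 - w\<^sup>2) * (w\<^sup>2 * b\<^sup>2 - a\<^sup>2)" using less w1 by simp
      then have "\<bar>w * b\<bar>\<^sup>2 + a\<^sup>2 / w\<^sup>2 \<le> a\<^sup>2 + b\<^sup>2"
        using w by (simp add: field_simps power2_eq_square)
      then show ?thesis using K0 p by (intro mult_left_mono powr_mono2) auto
    qed
    finally show "\<bar>a + w * b\<bar> powr p + \<bar>a - w * b\<bar> powr p \<le> K * (a\<^sup>2 + b\<^sup>2) powr (p / 2)" .
  qed
qed

section \<open>The exponent at the saddle point\<close>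

text \<open>The saddle point parametrisation of \<open>h_fun p y = 1 - 2 * x\<close>: both \<open>x\<close> and \<open>y\<close> are explicit
  functions of \<open>z \<in> [0, 1]\<close>.\<close>

definition saddle_x :: "real \<Rightarrow> real \<Rightarrow> real" where
  "saddle_x p z = z * pdiff (p - 1) z / psum p z"

definition saddle_y :: "real \<Rightarrow> real \<Rightarrow> real" where
  "saddle_y p z = (1 - z) powr p / psum p z"

lemma one_minus_saddle_x:
  assumes "0 \<le> z" "z \<le> 1"
  shows "1 - saddle_x p z = psum (p - 1) z / psum p z"
proof -
  have "psum p z \<noteq> 0" using psum_pos[of z p] assms by simp
  then have "1 - saddle_x p z = (psum p z - z * pdiff (p - 1) z) / psum p z"
    unfolding saddle_x_def by (simp add: diff_divide_distrib)
  also have "psum p z - z * pdiff (p - 1) z = psum (p - 1) z"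
    using psum_rec[OF assms, of p] by simp
  finally show ?thesis .
qed

lemma one_minus_two_saddle_x:
  assumes "0 \<le> z" "z \<le> 1"
  shows "1 - 2 * saddle_x p z = (psum (p - 1) z - z * pdiff (p - 1) z) / psum p z"
proof -
  have "1 - 2 * saddle_x p z = (1 - saddle_x p z) - saddle_x p z" by simp
  also have "\<dots> = psum (p - 1) z / psum p z - z * pdiff (p - 1) z / psum p z"
    using one_minus_saddle_x[OF assms, of p] by (simp add: saddle_x_def)
  finally show ?thesis by (simp add: diff_divide_distrib)
qed

lemma one_minus_saddle_y:
  assumes "0 \<le> z"
  shows "1 - saddle_y p z = (1 + z) powr p / psum p z"
  unfolding saddle_y_def using psum_pos[OF assms, of p] by (simp add: field_simps psum_def)

text \<open>Both \<open>saddle_y p z\<close> and its complement are p-th powers divided by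
  \<open>psum p z\<close>, so the exponents \<open>1 / p\<close> and \<open>(p - 1) / p\<close>
  leave only mixed products of \<open>1 - z\<close> and \<open>1 + z\<close> over
  \<open>psum p z\<close>.\<close>

lemma h_fun_saddle_y:
  assumes p: "p \<ge> 2" and z: "0 \<le> z" "z \<le> 1"
  shows "h_fun p (saddle_y p z) = 1 - 2 * saddle_x p z"
proof -
  have P: "psum p z > 0" using psum_pos z by simp
  have root: "(t powr p / psum p z) powr (r / p) = t powr r / psum p z powr (r / p)" if "t \<ge> 0" for t r
    using that P p by (simp add: powr_divide powr_powr)
  have PP: "psum p z powr (1 / p) * psum p z powr ((p - 1) / p) = psum p z"
    using P p by (simp flip: powr_add add_divide_distrib)
  have "h_fun p (saddle_y p z) = ((1 - z) * (1 + z) powr (p - 1) + (1 - z) powr (p - 1) * (1 + z))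
      / (psum p z powr (1 / p) * psum p z powr ((p - 1) / p))"
    unfolding h_fun_def one_minus_saddle_y[OF z(1)] unfolding saddle_y_def
    using z root[of "1 - z" 1] root[of "1 - z" "p - 1"] root[of "1 + z" 1] root[of "1 + z" "p - 1"]
    by (simp add: add_divide_distrib[of _ "_ * _"] mult.commute)
  also have "\<dots> = (psum (p - 1) z - z * pdiff (p - 1) z) / psum p z"
    unfolding PP psum_def[of "p - 1"] pdiff_def by (simp add: algebra_simps)
  also have "\<dots> = 1 - 2 * saddle_x p z"
    using one_minus_two_saddle_x[OF z] by simp
  finally show ?thesis .
qed

section \<open>Endpoints, surjectivity and monotonicity of the parametrisation\<close>

lemma saddle_x_0 [simp]: "saddle_x p 0 = 0"
  by (simp add: saddle_x_def)

lemma saddle_x_1 [simp]: "saddle_x p 1 = 1 / 2"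
proof -
  have "(2::real) powr p = 2 * 2 powr (p - 1)" by (simp add: powr_diff)
  then show ?thesis by (simp add: saddle_x_def pdiff_def psum_def)
qed

lemma saddle_y_0 [simp]: "saddle_y p 0 = 1 / 2"
  by (simp add: saddle_y_def psum_def)

lemma saddle_y_1 [simp]: "saddle_y p 1 = 0"
  by (simp add: saddle_y_def)

lemma psum_nonzero: "0 \<le> z \<Longrightarrow> psum r z \<noteq> 0"
  using psum_pos[of z r] by simp

lemma saddle_x_surj:
  assumes "p \<ge> 2" "0 \<le> x" "x \<le> 1 / 2"
  shows "\<exists>z. 0 \<le> z \<and> z \<le> 1 \<and> saddle_x p z = x"
proof (rule IVT')
  show "continuous_on {0..1} (saddle_x p)"
    unfolding saddle_x_def using assms(1)
    by (intro continuous_intros continuous_on_psum continuous_on_pdiff) (auto simp: psum_nonzero)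
qed (use assms in auto)

lemma saddle_y_surj:
  assumes "p \<ge> 2" "0 \<le> y" "y \<le> 1 / 2"
  shows "\<exists>z. 0 \<le> z \<and> z \<le> 1 \<and> saddle_y p z = y"
proof (rule IVT2')
  show "continuous_on {0..1} (saddle_y p)"
    unfolding saddle_y_def using assms(1)
    by (intro continuous_intros continuous_on_psum continuous_on_powr') (auto simp: psum_nonzero)
qed (use assms in auto)

text \<open>With \<open>N = pdiff (p - 1)\<close> and \<open>S = psum (p - 1)\<close>, the ratio
  \<open>N / S\<close> is nondecreasing, so \<open>t * N / S\<close> is strictly increasing;
  \<open>saddle_x\<close> is its image under the increasing map \<open>r / (1 + r)\<close>.\<close>

lemma saddle_x_strict_mono:
  assumes p: "p \<ge> 2" and z: "0 \<le> z" "z < z'" "z' \<le> 1"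
  shows "saddle_x p z < saddle_x p z'"
proof -
  define S N where "S t = psum (p - 1) t" and "N t = pdiff (p - 1) t" for t
  have S: "S z > 0" "S z' > 0" unfolding S_def using z by (auto intro: psum_pos)
  have N: "N z \<ge> 0" "N z' > 0"
    unfolding N_def using z p by (auto intro: pdiff_nonneg pdiff_pos)
  have "(1 + z) powr (p - 1) * (1 - z') powr (p - 1) \<le> (1 + z') powr (p - 1) * (1 - z) powr (p - 1)"
    using z p by (intro mult_mono powr_mono2) auto
  then have "N z * S z' \<le> N z' * S z"
    unfolding S_def N_def psum_def pdiff_def by (simp add: algebra_simps)
  then have "z * (N z * S z') \<le> z * (N z' * S z)" using z by (intro mult_left_mono) auto
  also have "\<dots> < z' * (N z' * S z)" using z S N by (intro mult_strict_right_mono) auto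
  finally have "z * N z * (S z' + z' * N z') < z' * N z' * (S z + z * N z)"
    by (simp add: algebra_simps)
  moreover have "saddle_x p t = t * N t / (S t + t * N t)" if "0 \<le> t" "t \<le> 1" for t
    unfolding saddle_x_def N_def S_def psum_rec[OF that, of p] ..
  moreover have "S z + z * N z > 0" "S z' + z' * N z' > 0"
    using S N z by (auto intro: add_pos_nonneg)
  ultimately show ?thesis using z by (simp add: frac_less_eq divide_neg_pos del: times_divide_eq_left)
qed

lemma saddle_y_range: "0 \<le> z \<Longrightarrow> z \<le> 1 \<Longrightarrow> p \<ge> 2 \<Longrightarrow> 0 \<le> saddle_y p z \<and> saddle_y p z \<le> 1 / 2"
  unfolding saddle_y_def using psum_pos[of z p] powr_mono2[of p "1 - z" "1 + z"]
  by (simp add: field_simps) (simp add: psum_def)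

text \<open>Uniqueness comes from the parameter: another solution is \<open>saddle_y p z'\<close>
  for some \<open>z'\<close>, both parameters then give the same \<open>saddle_x\<close>, and strict
  monotonicity identifies them.\<close>

lemma the_h_fun_solution:
  assumes p: "p \<ge> 2" and z: "0 \<le> z" "z \<le> 1"
  shows "(THE y. 0 \<le> y \<and> y \<le> 1 / 2 \<and> h_fun p y = 1 - 2 * saddle_x p z) = saddle_y p z"
proof (rule the_equality)
  show "0 \<le> saddle_y p z \<and> saddle_y p z \<le> 1 / 2 \<and> h_fun p (saddle_y p z) = 1 - 2 * saddle_x p z"
    using saddle_y_range[OF z p] h_fun_saddle_y[OF p z] by blast
next
  fix y assume y: "0 \<le> y \<and> y \<le> 1 / 2 \<and> h_fun p y = 1 - 2 * saddle_x p z"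
  then obtain z' where z': "0 \<le> z'" "z' \<le> 1" "saddle_y p z' = y" using saddle_y_surj[OF p, of y] by auto
  then have "saddle_x p z' = saddle_x p z" using y h_fun_saddle_y[OF p z'(1,2)] by simp
  then have "z' = z"
    using saddle_x_strict_mono[OF p, of z z'] saddle_x_strict_mono[OF p, of z' z] z z' by linarith
  then show "y = saddle_y p z" using z' by simp
qed

section \<open>Evaluation of \<open>tau\<close> and \<open>psi\<close> along the
  parametrisation\<close>

lemma binary_entropy_minus_I_fun_0:
  assumes "0 < x" "x < 1 / 2"
  shows "binary_entropy x - I_fun 0 x = 1 + x + (x - 1 / 2) * log 2 (1 - x)"
proof -
  have l8: "log 2 8 = (3::real)" using log_pow_cancel[of 2 3] by simp
  have "I_fun 0 x = (1 - 2 * x) / 2 * log 2 (2 * x) - 1 / 2 * log 2 (8 * x * (1 - x))"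
  proof -
    have e: "2 - (1 - 2 * x)\<^sup>2 - (1 - 2 * x) * (1 - 2 * x) = 8 * x * (1 - x)"
      by (simp add: power2_eq_square algebra_simps)
    \<comment> \<open>At \<open>u = 0\<close> the root \<open>b\<close> equals \<open>a\<close>, so
      \<open>I_fun\<close> becomes elementary.\<close>
    have "sqrt ((1 - 2 * x)\<^sup>2) = 1 - 2 * x" using assms by simp
    then show ?thesis using assms e unfolding I_fun_def Let_def by simp
  qed
  also have "\<dots> = (1 - 2 * x) / 2 * (1 + log 2 x) - 1 / 2 * (3 + log 2 x + log 2 (1 - x))"
    using assms by (simp add: log_mult l8)
  finally show ?thesis unfolding binary_entropy_def by (simp add: algebra_simps)
qed

text \<open>The radicand in \<open>I_fun\<close> is a perfect square along the parametrisation. The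
  arguments of the logarithms then factor into powers of 2, \<open>z\<close>, \<open>1 - z\<close>,
  \<open>1 + z\<close>, \<open>1 - x\<close> and \<open>1 - y\<close>, and the last two
  cancel.\<close>

lemma tau_saddle:
  assumes p: "p \<ge> 2" and z: "0 < z" "z < 1"
  defines "x \<equiv> saddle_x p z" and "y \<equiv> saddle_y p z"
  shows "tau x y = y * log 2 (1 - z) + (1 - y) * log 2 (1 + z) - x * log 2 z"
proof -
  have P: "psum p z > 0" and S: "psum (p - 1) z > 0" using psum_pos z by auto
  have y0: "y > 0" unfolding y_def saddle_y_def using P z by simp
  have y1: "1 - y > 0" unfolding y_def using one_minus_saddle_y[of z p] P z by simp
  have x0: "0 < x" "x < 1 / 2"
    using saddle_x_strict_mono[OF p, of 0 z] saddle_x_strict_mono[OF p, of z 1] z unfolding x_def by auto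
  \<comment> \<open>The roots of \<open>t^2 - (1 - 2 * x) * t + y * (1 - y)\<close>, whose
    discriminant is the radicand in \<open>I_fun y x\<close>.\<close>
  define A B where "A = (1 - y) * (1 - z) / (1 + z)" and "B = y * (1 + z) / (1 - z)"
  have A: "A = (1 - z) * (1 + z) powr (p - 1) / psum p z"
    unfolding A_def y_def one_minus_saddle_y[OF less_imp_le[OF z(1)]]
    using z by (simp add: powr_minus_one_mult[of "1 + z" p, symmetric])
  have B: "B = (1 + z) * (1 - z) powr (p - 1) / psum p z"
    unfolding B_def y_def saddle_y_def
    using z by (simp add: powr_minus_one_mult[of "1 - z" p, symmetric])
  have a: "1 - 2 * x = A + B"
  proof -
    have "1 - 2 * x = (psum (p - 1) z - z * pdiff (p - 1) z) / psum p z"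
      using one_minus_two_saddle_x z unfolding x_def by simp
    then show ?thesis unfolding A B psum_def[of "p - 1"] pdiff_def
      by (simp add: algebra_simps add_divide_distrib[symmetric])
  qed
  \<comment> \<open>This order decides that the square root below is \<open>A - B\<close> and not
    \<open>B - A\<close>.\<close>
  have AB: "B \<le> A"
    using mixed_powr_le[of z p] z p P unfolding A B by (intro divide_right_mono) (auto simp: mult.commute)
  have "(1 - y) * c / d * (y * d / c) = y * (1 - y)" if "c \<noteq> 0" "d \<noteq> 0" for c d
    using that by simp
  from this[of "1 - z" "1 + z"] have AmB: "A * B = y * (1 - y)"
    unfolding A_def B_def using z by simp
  have b: "sqrt ((1 - 2 * x)\<^sup>2 - 4 * y * (1 - y)) = A - B"
  proof -
    have "(1 - 2 * x)\<^sup>2 - 4 * y * (1 - y) = (A - B)\<^sup>2"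
      unfolding a using AmB by (simp add: power2_eq_square algebra_simps)
    then show ?thesis using AB by simp
  qed
  \<comment> \<open>For \<open>y \<le> 1 / 2\<close>, nonnegativity of the radicand is exactly the
    condition of the first case of \<open>tau\<close>.\<close>
  have branch: "y \<le> 1 / 2 - sqrt (x * (1 - x))"
  proof -
    have y2: "y \<le> 1 / 2" using saddle_y_range[of z p] z p unfolding y_def by simp
    have "4 * y * (1 - y) \<le> (1 - 2 * x)\<^sup>2"
      unfolding a using AmB zero_le_power2[of "A - B"] by (simp add: power2_eq_square algebra_simps)
    then have "x * (1 - x) \<le> (1 / 2 - y)\<^sup>2" by (simp add: power2_eq_square algebra_simps)
    then have "sqrt (x * (1 - x)) \<le> \<bar>1 / 2 - y\<bar>" by (metis real_sqrt_abs real_sqrt_le_mono)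
    then show ?thesis using y2 by simp
  qed
  \<comment> \<open>The saddle point equation
    \<open>x = z * ((1 - y) / (1 + z) - y / (1 - z))\<close>, rearranged.\<close>
  have x1: "1 - x = y / (1 - z) + (1 - y) / (1 + z)"
  proof -
    have "2 * (1 - x) = 1 + (A + B)" using a by simp
    also have "\<dots> = (1 - y) + A + (y + B)" by simp
    also have "(1 - y) + A = 2 * ((1 - y) / (1 + z))" unfolding A_def using z by (simp add: field_simps)
    also have "y + B = 2 * (y / (1 - z))" unfolding B_def using z by (simp add: field_simps)
    finally have "2 * (1 - x) = 2 * (y / (1 - z) + (1 - y) / (1 + z))"
      by (simp only: distrib_left add.commute)
    then show ?thesis by (simp only: mult_cancel_left) simp
  qed
  have arg1: "1 - 2 * y - (A - B) = 2 * z * (1 - x)"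
  proof -
    have "1 - 2 * y - (A - B) = ((1 - y) - A) + (B - y)" by simp
    also have "(1 - y) - A = 2 * z * ((1 - y) / (1 + z))" unfolding A_def using z by (simp add: field_simps)
    also have "B - y = 2 * z * (y / (1 - z))" unfolding B_def using z by (simp add: field_simps)
    finally show ?thesis unfolding x1 by (simp add: algebra_simps)
  qed
  have arg2: "((1 - 2 * x) + (A - B)) / (2 * (1 - y)) = (1 - z) / (1 + z)"
  proof -
    have "(1 - 2 * x) + (A - B) = 2 * (1 - y) * ((1 - z) / (1 + z))"
      unfolding a by (simp add: A_def)
    moreover have nz: "2 * (1 - y) \<noteq> 0" using y1 by simp
    ultimately show ?thesis unfolding nonzero_divide_eq_eq[OF nz] by (simp only: mult.commute)
  qed
  have arg3: "2 * (1 - y) - (1 - 2 * x)\<^sup>2 - (1 - 2 * x) * (A - B) = 8 * z * (1 - y)\<^sup>2 / (1 + z)\<^sup>2"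
  proof -
    have "2 * (1 - y) - (1 - 2 * x)\<^sup>2 - (1 - 2 * x) * (A - B) = 2 * (1 - y) - 2 * A\<^sup>2 - 2 * (A * B)"
      unfolding a by (simp add: power2_eq_square algebra_simps)
    also have "\<dots> = 2 * (1 - y)\<^sup>2 - 2 * A\<^sup>2" unfolding AmB by (simp add: power2_eq_square algebra_simps)
    also have "\<dots> = 2 * (1 - y)\<^sup>2 * (1 - (1 - z)\<^sup>2 / (1 + z)\<^sup>2)"
      unfolding A_def power_divide power_mult_distrib by (simp add: right_diff_distrib)
    also have "1 - (1 - z)\<^sup>2 / (1 + z)\<^sup>2 = ((1 + z)\<^sup>2 - (1 - z)\<^sup>2) / (1 + z)\<^sup>2"
      using z by (simp add: diff_divide_distrib)
    also have "(1 + z)\<^sup>2 - (1 - z)\<^sup>2 = 4 * z"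
      by (simp add: power2_eq_square algebra_simps)
    finally show ?thesis by simp
  qed
  have l8: "log 2 8 = (3::real)" using log_pow_cancel[of 2 3] by simp
  have "I_fun y x = log 2 (1 - y) + (1 - 2 * x) / 2 * log 2 (2 * z * (1 - x))
      + y * log 2 ((1 - z) / (1 + z)) - 1 / 2 * log 2 (8 * z * (1 - y)\<^sup>2 / (1 + z)\<^sup>2)"
    unfolding I_fun_def Let_def b arg1 arg2 arg3 using x0 by simp
  also have "log 2 (2 * z * (1 - x)) = 1 + log 2 z + log 2 (1 - x)"
    using z x0 by (simp add: log_mult)
  also have "log 2 ((1 - z) / (1 + z)) = log 2 (1 - z) - log 2 (1 + z)"
    using z by (simp add: log_divide)
  also have "log 2 (8 * z * (1 - y)\<^sup>2 / (1 + z)\<^sup>2) = 3 + log 2 z + 2 * log 2 (1 - y) - 2 * log 2 (1 + z)"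
    using z y1 by (simp add: log_divide log_mult log_nat_power l8)
  finally have I: "I_fun y x = log 2 (1 - y) + (1 - 2 * x) / 2 * (1 + log 2 z + log 2 (1 - x))
      + y * (log 2 (1 - z) - log 2 (1 + z))
      - 1 / 2 * (3 + log 2 z + 2 * log 2 (1 - y) - 2 * log 2 (1 + z))" .
  have "tau x y = (binary_entropy x - I_fun 0 x) + I_fun y x"
    unfolding tau_def using branch by simp
  then show ?thesis
    unfolding binary_entropy_minus_I_fun_0[OF x0] I by (simp add: field_simps)
qed

lemma psi_0: "p \<ge> 2 \<Longrightarrow> psi p 0 = 0"
  using the_h_fun_solution[of p 0]
  by (simp only: psi_def Let_def saddle_x_0 saddle_y_0) (simp add: tau_def I_fun_def binary_entropy_def log_divide)

text \<open>As \<open>y\<close> and \<open>1 - y\<close> are p-th powers divided by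
  \<open>psum p z\<close>, the entropy of \<open>y\<close> is \<open>log 2 (psum p z)\<close> minus
  exactly the part of \<open>p * tau x y\<close> that involves \<open>y\<close>.\<close>

lemma psi_saddle:
  assumes p: "p \<ge> 2" and z: "0 < z" "z \<le> 1"
  defines "x \<equiv> saddle_x p z"
  shows "psi p x = log 2 (psum p z / 2) - p * x * log 2 z - p / 2 * binary_entropy x"
proof (cases "z = 1")
  case True
  \<comment> \<open>Here \<open>x = 1 / 2\<close> and \<open>y = 0\<close>: the condition of the
    first case of \<open>tau\<close> holds with equality, and its two \<open>I_fun\<close> values
    coincide.\<close>
  have h: "sqrt (1 / 4) = (1 / 2 :: real)" by (simp add: real_sqrt_divide)
  have "psi p x = p / 2 - 1"
    unfolding psi_def Let_def x_def the_h_fun_solution[OF p less_imp_le[OF z(1)] z(2)]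
    unfolding True by (simp add: tau_def binary_entropy_def log_divide h)
  then show ?thesis unfolding x_def True psum_def binary_entropy_def by (simp add: log_divide)
next
  case False
  then have z1: "z < 1" using z by simp
  define y where "y = saddle_y p z"
  have P: "psum p z > 0" using psum_pos z by auto
  have ly: "log 2 y = p * log 2 (1 - z) - log 2 (psum p z)"
    unfolding y_def saddle_y_def using P z1 by (simp add: log_divide log_powr)
  have l1y: "log 2 (1 - y) = p * log 2 (1 + z) - log 2 (psum p z)"
    using one_minus_saddle_y[of z p] P z unfolding y_def by (simp add: log_divide log_powr)
  have "psi p x = binary_entropy y - 1 + p * tau x y - p / 2 * binary_entropy x"
    unfolding psi_def Let_def x_def y_def the_h_fun_solution[OF p less_imp_le[OF z(1)] z(2)] ..
  also have "tau x y = y * log 2 (1 - z) + (1 - y) * log 2 (1 + z) - x * log 2 z"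
    unfolding x_def y_def by (rule tau_saddle[OF p z(1) z1])
  also have "binary_entropy y = log 2 (psum p z) - p * (y * log 2 (1 - z) + (1 - y) * log 2 (1 + z))"
    unfolding binary_entropy_def ly l1y by (simp add: algebra_simps)
  finally show ?thesis using P by (simp add: log_divide algebra_simps)
qed

lemma two_powr_neg_binary_entropy:
  assumes "1 \<le> s" "s < n" "x = real s / real n"
  shows "2 powr (- (binary_entropy x * n)) = x ^ s * (1 - x) ^ (n - s)"
proof -
  have x: "0 < x" "x < 1" using assms by auto
  have "- (binary_entropy x * n) = (x * n) * log 2 x + ((1 - x) * n) * log 2 (1 - x)"
    unfolding binary_entropy_def by (simp add: algebra_simps)
  also have "x * n = s" using assms by simp
  also have "(1 - x) * n = real (n - s)" using assms by (simp add: field_simps of_nat_diff)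
  finally show ?thesis
    using x by (simp add: powr_add powr_realpow[symmetric] powr_powr[symmetric] mult.commute[of "real _"])
qed

text \<open>The last factor is the power \<open>p / 2\<close> of
  \<open>2 powr (- (binary_entropy x * n))\<close>, kept as a product so that it can be compared
  with \<open>(1 - x) ^ n\<close> in the upper bound and with a binomial probability in the lower
  one.\<close>

lemma two_powr_psi:
  assumes p: "p \<ge> 2" and s: "1 \<le> s" "real s \<le> real n / 2"
  defines "x \<equiv> real s / real n"
  obtains z where "0 < z" "z \<le> 1" "x = saddle_x p z"
    "2 powr (psi p x * n) = (psum p z / 2) ^ n * z powr (- (p * s)) * (x ^ s * (1 - x) ^ (n - s)) powr (p / 2)"
proof -
  have n: "n > 0" "s < n" using s by auto
  have x: "0 < x" "x \<le> 1 / 2" unfolding x_def using s n by (auto simp: field_simps)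
  obtain z where z: "0 \<le> z" "z \<le> 1" "saddle_x p z = x"
    using saddle_x_surj[OF p, of x] x by auto
  then have z0: "0 < z" using x by (cases "z = 0") auto
  have P: "psum p z > 0" using psum_pos z by auto
  have psi: "psi p x = log 2 (psum p z / 2) - p * x * log 2 z - p / 2 * binary_entropy x"
    using psi_saddle[OF p z0 z(2)] z(3) by simp
  have xn: "x * n = s" unfolding x_def using n by simp
  have "psi p x * n = log 2 (psum p z / 2) * n + log 2 z * (- (p * (x * n))) + (- (binary_entropy x * n)) * (p / 2)"
    unfolding psi by (simp add: algebra_simps)
  then have "2 powr (psi p x * n) = (2 powr log 2 (psum p z / 2)) powr n * (2 powr log 2 z) powr (- (p * s))
      * (2 powr (- (binary_entropy x * n))) powr (p / 2)"
    unfolding xn by (simp only: powr_add powr_powr)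
  also have "2 powr (- (binary_entropy x * n)) = x ^ s * (1 - x) ^ (n - s)"
    using s n x_def by (intro two_powr_neg_binary_entropy) auto
  finally have "2 powr (psi p x * n) = (psum p z / 2) ^ n * z powr (- (p * s)) * (x ^ s * (1 - x) ^ (n - s)) powr (p / 2)"
    using P z0 by (simp add: powr_realpow)
  with that z0 z show ?thesis by blast
qed

section \<open>Fourier analysis on the cube\<close>

lemma finite_cube [simp]: "finite (cube n)"
  unfolding cube_def by (intro finite_PiE) auto

lemma card_cube: "card (cube n) = 2 ^ n"
  unfolding cube_def by (subst card_PiE) (auto simp: numeral_2_eq_2)

lemma cube_nonempty: "cube n \<noteq> {}"
  by (metis card_cube card.empty power_not_zero zero_neq_numeral)

lemma cube_expectation_eq: "cube_expectation n g = (\<Sum>x\<in>cube n. g x) / 2 ^ n"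
  unfolding cube_expectation_def
  using integral_pmf_of_set[OF cube_nonempty finite_cube, of n g] by (simp add: card_cube)

lemma cube_0: "cube 0 = {\<lambda>_. undefined}"
  unfolding cube_def by simp

lemma sum_cube_Suc:
  fixes g :: "(nat \<Rightarrow> nat) \<Rightarrow> 'a::comm_monoid_add"
  shows "(\<Sum>x\<in>cube (Suc n). g x) = (\<Sum>x\<in>cube n. g (x(n := 0)) + g (x(n := 1)))"
proof -
  have inj: "inj_on (\<lambda>(b, x). x(n := b)) ({0, 1} \<times> cube n)"
    unfolding cube_def lessThan_Suc by (rule inj_combinator) auto
  have "cube (Suc n) = (\<lambda>(b, x). x(n := b)) ` ({0, 1} \<times> cube n)"
    unfolding cube_def lessThan_Suc by (rule PiE_insert_eq)
  then have "(\<Sum>x\<in>cube (Suc n). g x) = (\<Sum>(b, x)\<in>{0, 1} \<times> cube n. g (x(n := b)))"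
    by (simp only: sum.reindex[OF inj]) (simp add: case_prod_beta)
  also have "\<dots> = (\<Sum>b\<in>{0, 1}. \<Sum>x\<in>cube n. g (x(n := b)))"
    by (simp add: sum.cartesian_product)
  finally show ?thesis by (simp add: sum.distrib)
qed

lemma hamming_weight_0 [simp]: "hamming_weight 0 \<alpha> = 0"
  unfolding hamming_weight_def by simp

lemma hamming_weight_Suc [simp]:
  "hamming_weight (Suc n) (\<alpha>(n := a)) = hamming_weight n \<alpha> + (if a = 0 then 0 else 1)"
proof -
  have "{i \<in> {..<Suc n}. (\<alpha>(n := a)) i \<noteq> 0}
      = (if a = 0 then {} else {n}) \<union> {i \<in> {..<n}. \<alpha> i \<noteq> 0}"
    by (auto simp: less_Suc_eq)
  then show ?thesis unfolding hamming_weight_def by (simp add: card_insert_if)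
qed

lemma walsh_0 [simp]: "walsh 0 \<alpha> x = 1"
  unfolding walsh_def by simp

lemma walsh_Suc [simp]:
  "walsh (Suc n) (\<alpha>(n := a)) (x(n := b)) = (- 1) ^ (a * b) * walsh n \<alpha> x"
  unfolding walsh_def by (simp add: power_add)

definition walsh_series :: "nat \<Rightarrow> ((nat \<Rightarrow> nat) \<Rightarrow> real) \<Rightarrow> (nat \<Rightarrow> nat) \<Rightarrow> real" where
  "walsh_series n c x = (\<Sum>\<alpha>\<in>cube n. c \<alpha> * walsh n \<alpha> x)"

lemma walsh_series_Suc:
  "walsh_series (Suc n) c (x(n := b)) =
     walsh_series n (\<lambda>\<alpha>. c (\<alpha>(n := 0))) x + (- 1) ^ b * walsh_series n (\<lambda>\<alpha>. c (\<alpha>(n := 1))) x"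
  unfolding walsh_series_def sum_cube_Suc
  by (simp add: sum.distrib sum_distrib_left algebra_simps)

text \<open>The two values of the last coordinate give the mixed terms opposite signs, so they
  cancel. The bilinear form serves both second moments and correlations.\<close>

lemma walsh_series_parseval:
  "(\<Sum>x\<in>cube n. walsh_series n c x * walsh_series n d x) = 2 ^ n * (\<Sum>\<alpha>\<in>cube n. c \<alpha> * d \<alpha>)"
proof (induction n arbitrary: c d)
  case 0
  then show ?case by (simp add: cube_0 walsh_series_def)
next
  case (Suc n)
  have "(\<Sum>x\<in>cube (Suc n). walsh_series (Suc n) c x * walsh_series (Suc n) d x)
    = 2 * (\<Sum>x\<in>cube n. walsh_series n (\<lambda>\<alpha>. c (\<alpha>(n := 0))) x * walsh_series n (\<lambda>\<alpha>. d (\<alpha>(n := 0))) x)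
    + 2 * (\<Sum>x\<in>cube n. walsh_series n (\<lambda>\<alpha>. c (\<alpha>(n := 1))) x * walsh_series n (\<lambda>\<alpha>. d (\<alpha>(n := 1))) x)"
    unfolding sum_cube_Suc walsh_series_Suc sum_distrib_left sum.distrib[symmetric]
    by (intro sum.cong refl) (simp add: algebra_simps)
  also have "\<dots> = 2 ^ Suc n * (\<Sum>\<alpha>\<in>cube (Suc n). c \<alpha> * d \<alpha>)"
    unfolding Suc.IH sum_cube_Suc by (simp add: sum.distrib algebra_simps)
  finally show ?case .
qed

section \<open>Minkowski's inequality and tensorisation\<close>

lemma powr_convex_two:
  assumes q: "(q::real) \<ge> 1" and l: "0 < l" "l < (1::real)" and uv: "0 \<le> u" "0 \<le> (v::real)"
  shows "(u + v) powr q \<le> l powr (1 - q) * u powr q + (1 - l) powr (1 - q) * v powr q"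
proof -
  have eq: "t powr (1 - q) * u powr q = t * (u / t) powr q" if "t > 0" "u \<ge> 0" for t u :: real
    using that by (simp add: powr_diff powr_divide)
  have mono1: "l' powr (1 - q) \<ge> 1" if "0 < l'" "l' < 1" for l' :: real
    using powr_mono2'[of "1 - q" l' 1] that q by simp
  show ?thesis
  proof (cases "u = 0 \<or> v = 0")
    case True
    then show ?thesis
      using mult_right_mono[OF mono1[of l], of "u powr q"]
        mult_right_mono[OF mono1[of "1 - l"], of "v powr q"] l q by auto
  next
    case False
    \<comment> \<open>Convexity at \<open>u / l\<close> and \<open>v / (1 - l)\<close> with weights
      \<open>l\<close> and \<open>1 - l\<close>; it is applied to positive arguments, hence the
      separate case above.\<close>
    then have "u / l > 0" "v / (1 - l) > 0" using l uv by auto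
    then have "((1 - l) * (v / (1 - l)) + l * (u / l)) powr q
        \<le> (1 - l) * (v / (1 - l)) powr q + l * (u / l) powr q"
      using convex_onD[OF powr_convex[OF q], of l "v / (1 - l)" "u / l"] l by simp
    then show ?thesis using l uv by (simp add: eq add.commute)
  qed
qed

text \<open>The weight \<open>l = a / (a + b)\<close> in \<open>powr_convex_two\<close> turns the
  two terms into \<open>a\<close> and \<open>b\<close> times the common factor
  \<open>M * (a + b) powr (q - 1)\<close>.\<close>

lemma minkowski_two:
  fixes f g :: "'a \<Rightarrow> real"
  assumes q: "q \<ge> 1" and fg: "\<And>x. x \<in> A \<Longrightarrow> f x \<ge> 0" "\<And>x. x \<in> A \<Longrightarrow> g x \<ge> 0"
    and F: "(\<Sum>x\<in>A. f x powr q) \<le> M * a powr q" and G: "(\<Sum>x\<in>A. g x powr q) \<le> M * b powr q"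
    and ab: "a \<ge> 0" "b \<ge> 0" and A: "finite A"
  shows "(\<Sum>x\<in>A. (f x + g x) powr q) \<le> M * (a + b) powr q"
proof (cases "a = 0 \<or> b = 0")
  case True
  \<comment> \<open>A bound \<open>a = 0\<close> or \<open>b = 0\<close> forces the corresponding
    function to vanish on \<open>A\<close>, since \<open>0 powr q = 0\<close>.\<close>
  have zero: "f x = 0" if "(\<Sum>x\<in>A. f x powr q) \<le> 0" "x \<in> A" for f :: "'a \<Rightarrow> real" and x
    using that sum_nonneg_0[of A "\<lambda>x. f x powr q" x] A sum_nonneg[of A "\<lambda>x. f x powr q"]
    by fastforce
  have "(\<forall>x\<in>A. f x = 0) \<or> a \<noteq> 0" "(\<forall>x\<in>A. g x = 0) \<or> b \<noteq> 0"
    using F G zero[of f] zero[of g] by auto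
  with True F G show ?thesis by auto
next
  case False
  with ab have ab: "a > 0" "b > 0" by auto
  define l where "l = a / (a + b)"
  have l: "0 < l" "l < 1" "1 - l = b / (a + b)" unfolding l_def using ab by (auto simp: field_simps)
  have eq: "(c / (a + b)) powr (1 - q) * c powr q = c * (a + b) powr (q - 1)" if "c > 0" for c
  proof -
    have "(c / (a + b)) powr (1 - q) = c powr (1 - q) * (a + b) powr (q - 1)"
      using that ab by (simp add: powr_divide powr_minus_divide[of "a + b" "q - 1", simplified])
    moreover have "c powr (1 - q) * c powr q = c" using that by (simp flip: powr_add)
    ultimately show ?thesis by (simp add: mult_ac)
  qed
  have "(\<Sum>x\<in>A. (f x + g x) powr q)
      \<le> (\<Sum>x\<in>A. l powr (1 - q) * f x powr q + (1 - l) powr (1 - q) * g x powr q)"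
    using fg l q by (intro sum_mono powr_convex_two) auto
  also have "\<dots> = l powr (1 - q) * (\<Sum>x\<in>A. f x powr q) + (1 - l) powr (1 - q) * (\<Sum>x\<in>A. g x powr q)"
    by (simp add: sum.distrib sum_distrib_left)
  also have "\<dots> \<le> l powr (1 - q) * (M * a powr q) + (1 - l) powr (1 - q) * (M * b powr q)"
    using F G by (intro add_mono mult_left_mono) auto
  also have "\<dots> = M * (l powr (1 - q) * a powr q + (1 - l) powr (1 - q) * b powr q)"
    by (simp add: algebra_simps)
  also have "\<dots> = M * ((a + b) powr (q - 1) * (a + b))"
    unfolding l(3) unfolding l_def using eq[of a] eq[of b] ab by (simp add: algebra_simps)
  also have "(a + b) powr (q - 1) * (a + b) = (a + b) powr q"
    using ab powr_add[of "a + b" "q - 1" 1] by simp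
  finally show ?thesis .
qed

lemma square_powr_half: "(t\<^sup>2) powr (p / 2) = \<bar>t\<bar> powr p" for t p :: real
proof (cases "t = 0")
  case False
  then have "t\<^sup>2 = \<bar>t\<bar> powr 2" by simp
  then show ?thesis by (simp add: powr_powr del: powr_numeral)
qed simp

text \<open>Fixing the last coordinate writes the series as \<open>T c0 + w * T c1\<close> or
  \<open>T c0 - w * T c1\<close>. The two-point bound applies pointwise, and Minkowski with exponent
  \<open>p / 2 \<ge> 1\<close>, used for the squares of \<open>T c0\<close> and \<open>T c1\<close>,
  recombines the induction hypotheses.\<close>

lemma walsh_series_hypercontractive:
  assumes p: "p \<ge> 2" and K: "K \<ge> 0"
    and two_point: "\<And>a b. \<bar>a + w * b\<bar> powr p + \<bar>a - w * b\<bar> powr p \<le> K * (a\<^sup>2 + b\<^sup>2) powr (p / 2)"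
  shows "(\<Sum>x\<in>cube n. \<bar>walsh_series n (\<lambda>\<alpha>. w ^ hamming_weight n \<alpha> * c \<alpha>) x\<bar> powr p)
    \<le> K ^ n * (\<Sum>\<alpha>\<in>cube n. (c \<alpha>)\<^sup>2) powr (p / 2)"
proof (induction n arbitrary: c)
  case 0
  then show ?case by (simp add: cube_0 walsh_series_def square_powr_half)
next
  case (Suc n)
  define T where "T c x = walsh_series n (\<lambda>\<alpha>. w ^ hamming_weight n \<alpha> * c \<alpha>) x" for c x
  define c0 c1 where "c0 \<alpha> = c (\<alpha>(n := 0))" and "c1 \<alpha> = c (\<alpha>(n := 1))" for \<alpha>
  have split: "walsh_series (Suc n) (\<lambda>\<alpha>. w ^ hamming_weight (Suc n) \<alpha> * c \<alpha>) (x(n := b))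
      = T c0 x + (- 1) ^ b * (w * T c1 x)" for x b
    unfolding walsh_series_Suc T_def c0_def c1_def
    by (simp add: walsh_series_def sum_distrib_left mult_ac)
  have IH: "(\<Sum>x\<in>cube n. ((T d x)\<^sup>2) powr (p / 2)) \<le> K ^ n * (\<Sum>\<alpha>\<in>cube n. (d \<alpha>)\<^sup>2) powr (p / 2)" for d
    unfolding T_def using Suc.IH[of d] by (simp only: square_powr_half)
  have "(\<Sum>x\<in>cube (Suc n). \<bar>walsh_series (Suc n) (\<lambda>\<alpha>. w ^ hamming_weight (Suc n) \<alpha> * c \<alpha>) x\<bar> powr p)
      = (\<Sum>x\<in>cube n. \<bar>T c0 x + w * T c1 x\<bar> powr p + \<bar>T c0 x - w * T c1 x\<bar> powr p)"
    unfolding sum_cube_Suc split by simp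
  also have "\<dots> \<le> (\<Sum>x\<in>cube n. K * ((T c0 x)\<^sup>2 + (T c1 x)\<^sup>2) powr (p / 2))"
    by (intro sum_mono two_point)
  also have "\<dots> = K * (\<Sum>x\<in>cube n. ((T c0 x)\<^sup>2 + (T c1 x)\<^sup>2) powr (p / 2))"
    by (simp add: sum_distrib_left)
  also have "\<dots> \<le> K * (K ^ n * ((\<Sum>\<alpha>\<in>cube n. (c0 \<alpha>)\<^sup>2) + (\<Sum>\<alpha>\<in>cube n. (c1 \<alpha>)\<^sup>2)) powr (p / 2))"
    using p K IH by (intro mult_left_mono minkowski_two) (auto simp: sum_nonneg)
  also have "(\<Sum>\<alpha>\<in>cube n. (c0 \<alpha>)\<^sup>2) + (\<Sum>\<alpha>\<in>cube n. (c1 \<alpha>)\<^sup>2) = (\<Sum>\<alpha>\<in>cube (Suc n). (c \<alpha>)\<^sup>2)"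
    unfolding sum_cube_Suc c0_def c1_def by (simp add: sum.distrib)
  finally show ?case by (simp add: mult_ac)
qed

lemma sum_cube_weight_eq:
  fixes g :: "(nat \<Rightarrow> nat) \<Rightarrow> real"
  shows "(\<Sum>\<alpha>\<in>{\<alpha> \<in> cube n. hamming_weight n \<alpha> = s}. g \<alpha>)
    = (\<Sum>\<alpha>\<in>cube n. if hamming_weight n \<alpha> = s then g \<alpha> else 0)"
  by (simp add: sum.inter_filter)

text \<open>On weight \<open>s\<close> the multipliers \<open>w ^ hamming_weight n \<alpha>\<close>
  all equal \<open>w ^ s\<close>. The factor 2 in \<open>two_point\<close> is absorbed when sums
  over the cube become expectations.\<close>

lemma homogeneous_poly_hypercontractive:
  assumes p: "p \<ge> 2" and K: "K \<ge> 0" and w: "w \<ge> 0" and f: "homogeneous_poly n s f"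
    and two_point: "\<And>a b. \<bar>a + w * b\<bar> powr p + \<bar>a - w * b\<bar> powr p \<le> 2 * K * (a\<^sup>2 + b\<^sup>2) powr (p / 2)"
  shows "(w ^ s) powr p * cube_expectation n (\<lambda>x. \<bar>f x\<bar> powr p)
    \<le> K ^ n * cube_expectation n (\<lambda>x. (f x)\<^sup>2) powr (p / 2)"
proof -
  obtain c' where c': "\<And>x. x \<in> cube n \<Longrightarrow>
      f x = (\<Sum>\<alpha>\<in>{\<alpha> \<in> cube n. hamming_weight n \<alpha> = s}. c' \<alpha> * walsh n \<alpha> x)"
    using f unfolding homogeneous_poly_def by blast
  \<comment> \<open>The values of \<open>c'\<close> off weight \<open>s\<close> are arbitrary and
    have to be removed before the full Walsh series is formed.\<close>
  define c where "c \<alpha> = (if hamming_weight n \<alpha> = s then c' \<alpha> else 0)" for \<alpha>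
  have f_eq: "f x = walsh_series n c x" if "x \<in> cube n" for x
    unfolding c'[OF that] sum_cube_weight_eq walsh_series_def c_def by (intro sum.cong) auto
  have Tf: "walsh_series n (\<lambda>\<alpha>. w ^ hamming_weight n \<alpha> * c \<alpha>) x = w ^ s * f x" if "x \<in> cube n" for x
    unfolding f_eq[OF that] walsh_series_def sum_distrib_left c_def by (intro sum.cong) auto
  have "cube_expectation n (\<lambda>x. (f x)\<^sup>2) = (\<Sum>\<alpha>\<in>cube n. (c \<alpha>)\<^sup>2)"
    unfolding cube_expectation_eq using walsh_series_parseval[of n c c] f_eq
    by (simp add: power2_eq_square)
  moreover have "(w ^ s) powr p * (\<Sum>x\<in>cube n. \<bar>f x\<bar> powr p)
      = (\<Sum>x\<in>cube n. \<bar>walsh_series n (\<lambda>\<alpha>. w ^ hamming_weight n \<alpha> * c \<alpha>) x\<bar> powr p)"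
    unfolding sum_distrib_left using w
    by (intro sum.cong) (auto simp: Tf abs_mult powr_mult)
  moreover have "\<dots> \<le> (2 * K) ^ n * (\<Sum>\<alpha>\<in>cube n. (c \<alpha>)\<^sup>2) powr (p / 2)"
    using p K two_point by (intro walsh_series_hypercontractive) auto
  ultimately show ?thesis
    unfolding cube_expectation_eq by (simp add: field_simps power_mult_distrib)
qed

lemma card_cube_weight: "card {\<alpha> \<in> cube n. hamming_weight n \<alpha> = s} = n choose s"
proof -
  have "(\<Sum>\<alpha>\<in>cube n. if hamming_weight n \<alpha> = s then 1 else 0) = n choose s"
  proof (induction n arbitrary: s)
    case 0
    then show ?case by (cases s) (auto simp: cube_0)
  next
    case (Suc n)
    show ?case
    proof (cases s)
      case 0
      then show ?thesis using Suc.IH[of 0] by (simp add: sum_cube_Suc sum.distrib)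
    next
      case (Suc t)
      then show ?thesis using Suc.IH[of t] Suc.IH[of "Suc t"] by (simp add: sum_cube_Suc sum.distrib)
    qed
  qed
  then show ?thesis unfolding card_eq_sum by (simp only: sum.inter_filter[OF finite_cube])
qed

section \<open>Krawchouk polynomials and their generating function\<close>

lemma krawchouk_eq_walsh_series:
  "krawchouk n s = walsh_series n (\<lambda>\<alpha>. if hamming_weight n \<alpha> = s then 1 else 0)"
  unfolding krawchouk_def walsh_series_def sum_cube_weight_eq by (intro ext sum.cong) auto

lemma krawchouk_second_moment: "cube_expectation n (\<lambda>x. (krawchouk n s x)\<^sup>2) = real (n choose s)"
proof -
  have "(\<Sum>\<alpha>\<in>cube n. (if hamming_weight n \<alpha> = s then 1 else 0) * (if hamming_weight n \<alpha> = s then 1 else 0))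
      = (\<Sum>\<alpha>\<in>cube n. if hamming_weight n \<alpha> = s then 1 else (0::real))"
    by (intro sum.cong) auto
  also have "\<dots> = real (n choose s)"
    using sum_cube_weight_eq[of "\<lambda>_. 1" n s] by (simp add: card_cube_weight)
  finally have "(\<Sum>\<alpha>\<in>cube n. (if hamming_weight n \<alpha> = s then 1 else 0) * (if hamming_weight n \<alpha> = s then 1 else 0))
      = real (n choose s)" .
  then show ?thesis
    unfolding cube_expectation_eq power2_eq_square krawchouk_eq_walsh_series walsh_series_parseval
    by simp
qed

text \<open>The function \<open>y \<mapsto> (1 + z) ^ (n - |y|) * (1 - z) ^ |y|\<close>, whose coefficient at \<open>z ^ s\<close>
  is \<open>krawchouk n s y\<close>.\<close>

definition gen :: "nat \<Rightarrow> real \<Rightarrow> (nat \<Rightarrow> nat) \<Rightarrow> real" where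
  "gen n z x = (\<Prod>i<n. 1 + (- 1) ^ x i * z)"

lemma gen_Suc: "gen (Suc n) z (x(n := b)) = gen n z x * (1 + (- 1) ^ b * z)"
  unfolding gen_def by simp

lemma gen_eq_walsh_series: "x \<in> cube n \<Longrightarrow> gen n z x = walsh_series n (\<lambda>\<alpha>. z ^ hamming_weight n \<alpha>) x"
proof (induction n arbitrary: x)
  case 0
  show ?case by (simp add: cube_0 walsh_series_def gen_def)
next
  case (Suc n)
  have "x \<in> (\<lambda>(b, y). y(n := b)) ` ({0, 1} \<times> cube n)"
    using Suc.prems unfolding cube_def lessThan_Suc PiE_insert_eq .
  then obtain y b where x: "x = y(n := b)" "y \<in> cube n" by auto
  show ?case
    unfolding x gen_Suc walsh_series_Suc Suc.IH[OF x(2)]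
    by (simp add: walsh_series_def sum_distrib_left sum.distrib algebra_simps)
qed

lemma gen_nonneg: "\<bar>z\<bar> \<le> 1 \<Longrightarrow> gen n z x \<ge> 0"
  unfolding gen_def by (intro prod_nonneg) (auto simp: minus_one_power_iff)

text \<open>On a sign e, \<open>(1 + e * z) powr r\<close> is an affine function of e, here written
  \<open>a * (1 + e * u)\<close>. The product over the coordinates is again a multiple of a
  generating function.\<close>

lemma gen_powr:
  assumes "0 \<le> z" "z \<le> 1"
    and "a * (1 + u) = (1 + z) powr r" "a * (1 - u) = (1 - z) powr r"
  shows "gen n z x powr r = a ^ n * gen n u x"
proof -
  have "(1 + (- 1) ^ k * z) powr r = a * (1 + (- 1) ^ k * u)" for k :: nat
    using assms by (auto simp: minus_one_power_iff)
  then show ?thesis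
    unfolding gen_def using assms
    by (subst prod_powr_distrib) (auto simp: prod.distrib minus_one_power_iff)
qed

lemma gen_moment:
  assumes "0 \<le> z" "z \<le> 1"
  shows "cube_expectation n (\<lambda>x. gen n z x powr p) = (((1 + z) powr p + (1 - z) powr p) / 2) ^ n"
proof -
  have "(\<Sum>x\<in>cube n. gen n z x powr p) = ((1 + z) powr p + (1 - z) powr p) ^ n"
  proof (induction n)
    case 0
    then show ?case by (simp add: cube_0 gen_def)
  next
    case (Suc n)
    have "gen (Suc n) z (x(n := 0)) powr p + gen (Suc n) z (x(n := 1)) powr p
        = ((1 + z) powr p + (1 - z) powr p) * gen n z x powr p" for x
      unfolding gen_Suc powr_mult by (simp add: algebra_simps)
    then have "(\<Sum>x\<in>cube (Suc n). gen (Suc n) z x powr p)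
        = ((1 + z) powr p + (1 - z) powr p) * (\<Sum>x\<in>cube n. gen n z x powr p)"
      by (simp only: sum_cube_Suc sum_distrib_left)
    then show ?case using Suc.IH by simp
  qed
  then show ?thesis unfolding cube_expectation_eq by (simp add: power_divide)
qed

text \<open>Parseval: \<open>gen n u\<close> has coefficient \<open>u ^ s\<close> at each of the
  \<open>n choose s\<close> characters of weight \<open>s\<close>.\<close>

lemma krawchouk_gen_correlation:
  "cube_expectation n (\<lambda>x. krawchouk n s x * gen n u x) = real (n choose s) * u ^ s"
proof -
  have "(\<Sum>\<alpha>\<in>cube n. (if hamming_weight n \<alpha> = s then 1 else 0) * u ^ hamming_weight n \<alpha>)
      = (\<Sum>\<alpha>\<in>{\<alpha> \<in> cube n. hamming_weight n \<alpha> = s}. u ^ s)"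
    unfolding sum_cube_weight_eq by (intro sum.cong) auto
  then have "(\<Sum>\<alpha>\<in>cube n. (if hamming_weight n \<alpha> = s then 1 else 0) * u ^ hamming_weight n \<alpha>)
      = real (n choose s) * u ^ s"
    by (simp add: card_cube_weight)
  moreover have "(\<Sum>x\<in>cube n. krawchouk n s x * gen n u x)
      = (\<Sum>x\<in>cube n. krawchouk n s x * walsh_series n (\<lambda>\<alpha>. u ^ hamming_weight n \<alpha>) x)"
    by (intro sum.cong) (auto simp: gen_eq_walsh_series)
  ultimately show ?thesis
    unfolding cube_expectation_eq krawchouk_eq_walsh_series walsh_series_parseval by simp
qed

section \<open>Lower bounds for moments by testing\<close>

lemma powr_tangent:
  fixes t m p :: real
  assumes "p \<ge> 1" "t \<ge> 0" "m > 0"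
  shows "t powr p \<ge> p * m powr (p - 1) * t - (p - 1) * m powr p"
proof (cases "t = 0")
  case True
  then show ?thesis using assms by simp
next
  case False
  have "p * m powr (p - 1) * (t - m) \<le> t powr p - m powr p"
  proof (rule convex_on_imp_above_tangent[where A = "{0<..}"])
    show "convex_on {0<..} (\<lambda>x::real. x powr p)" using assms by (intro powr_convex)
    show "((\<lambda>x. x powr p) has_real_derivative p * m powr (p - 1)) (at m within {0<..})"
      using assms by (auto intro!: derivative_eq_intros)
  qed (use assms False in \<open>auto simp: interior_open\<close>)
  moreover have "m powr p = m powr (p - 1) * m" using assms powr_add[of m "p - 1" 1] by simp
  ultimately show ?thesis by (simp add: algebra_simps)
qed

text \<open>Testing \<open>f\<close> against \<open>g ^ (p - 1)\<close>; this is Hoelder's inequality, with the dual exponent eliminated.\<close>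

lemma moment_lower_bound:
  fixes f g :: "'a \<Rightarrow> real"
  assumes p: "p \<ge> 1" and m: "m > 0" and g: "\<And>x. x \<in> A \<Longrightarrow> g x \<ge> 0"
    and corr: "(\<Sum>x\<in>A. f x * g x powr (p - 1)) = m * (\<Sum>x\<in>A. g x powr p)"
  shows "m powr p * (\<Sum>x\<in>A. g x powr p) \<le> (\<Sum>x\<in>A. \<bar>f x\<bar> powr p)"
proof -
  \<comment> \<open>The tangent of \<open>t powr p\<close> at \<open>t = m * g x\<close>, evaluated
    at \<open>|f x|\<close>. After summation \<open>corr\<close> leaves
    \<open>p - (p - 1) = 1\<close> copy of the desired left-hand side.\<close>
  have pw: "p * m powr (p - 1) * (f x * g x powr (p - 1)) - (p - 1) * m powr p * g x powr p
      \<le> \<bar>f x\<bar> powr p" if "x \<in> A" for x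
  proof (cases "g x = 0")
    case False
    then have gx: "g x > 0" using g[OF that] by simp
    have "p * m powr (p - 1) * (f x * g x powr (p - 1)) - (p - 1) * m powr p * g x powr p
        = p * (m * g x) powr (p - 1) * f x - (p - 1) * (m * g x) powr p"
      using m gx by (simp add: powr_mult)
    also have "\<dots> \<le> p * (m * g x) powr (p - 1) * \<bar>f x\<bar> - (p - 1) * (m * g x) powr p"
      using p by (intro diff_right_mono mult_left_mono) auto
    also have "\<dots> \<le> \<bar>f x\<bar> powr p"
      using p m gx by (intro powr_tangent) auto
    finally show ?thesis .
  qed auto
  have "m powr p = m powr (p - 1) * m" using m powr_add[of m "p - 1" 1] by simp
  then have "m powr p * (\<Sum>x\<in>A. g x powr p)
      = p * m powr (p - 1) * (\<Sum>x\<in>A. f x * g x powr (p - 1)) - (p - 1) * m powr p * (\<Sum>x\<in>A. g x powr p)"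
    unfolding corr by (simp add: algebra_simps)
  also have "\<dots> = (\<Sum>x\<in>A. p * m powr (p - 1) * (f x * g x powr (p - 1)) - (p - 1) * m powr p * g x powr p)"
    by (simp add: sum_subtractf sum_distrib_left)
  also have "\<dots> \<le> (\<Sum>x\<in>A. \<bar>f x\<bar> powr p)" by (intro sum_mono pw)
  finally show ?thesis .
qed

section \<open>The central binomial probability\<close>

lemma Bernstein_Suc:
  assumes "k < n"
  shows "Bernstein n (Suc k) x * (real (Suc k) * (1 - x)) = Bernstein n k x * (real (n - k) * x)"
proof -
  have "Suc k * (n choose Suc k) = (n - k) * (n choose k)"
    by (simp only: binomial_absorption binomial_absorb_comp)
  then have c: "real (n choose Suc k) * real (Suc k) = real (n choose k) * real (n - k)"
    by (metis mult.commute of_nat_mult)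
  have e: "n - k = Suc (n - Suc k)" using assms by simp
  have "Bernstein n (Suc k) x * (real (Suc k) * (1 - x))
      = (real (n choose Suc k) * real (Suc k)) * x * x ^ k * ((1 - x) ^ (n - Suc k) * (1 - x))"
    unfolding Bernstein_def by (simp only: power_Suc mult_ac)
  also have "(1 - x) ^ (n - Suc k) * (1 - x) = (1 - x) ^ (n - k)"
    unfolding e by simp
  finally show ?thesis unfolding c Bernstein_def by (simp only: mult_ac)
qed

text \<open>The ratio of the term at \<open>j + 1\<close> to the term at \<open>j\<close> is
  \<open>(n - j) * s\<close> over \<open>(j + 1) * (n - s)\<close>, which is at least 1 for
  \<open>j < s\<close> and at most 1 for \<open>j \<ge> s\<close>.\<close>

lemma Bernstein_mode:
  assumes s: "0 < s" "s < n" and k: "k \<le> n"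
  shows "Bernstein n k (s / n) \<le> Bernstein n s (s / n)"
proof -
  define x where "x = real s / real n"
  have x: "0 < x" "x < 1" unfolding x_def using s by auto
  have nn: "Bernstein n j x \<ge> 0" for j using Bernstein_nonneg[of x] x by simp
  have xs: "real n * x = s" "real n * (1 - x) = real n - real s"
    unfolding x_def using s by (auto simp: field_simps)
  have step: "Bernstein n (Suc j) x * (real (Suc j) * (real n - real s)) = Bernstein n j x * (real (n - j) * real s)"
    if "j < n" for j
  proof -
    have "Bernstein n (Suc j) x * (real (Suc j) * (real n * (1 - x))) = Bernstein n j x * (real (n - j) * (real n * x))"
      using arg_cong[OF Bernstein_Suc[OF that, of x], of "\<lambda>t. real n * t"] by (simp only: mult_ac)
    then show ?thesis unfolding xs .
  qed
  have up: "Bernstein n j x \<le> Bernstein n (Suc j) x" if "j < s" for j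
  proof -
    have "real n * real (Suc j) \<le> real n * real s" using that by (intro mult_left_mono) auto
    then have "real (Suc j) * (real n - real s) \<le> real (n - j) * real s"
      using that s by (simp add: of_nat_diff algebra_simps)
    then have "Bernstein n (Suc j) x * (real (Suc j) * (real n - real s)) \<le> Bernstein n (Suc j) x * (real (n - j) * real s)"
      using nn by (intro mult_left_mono)
    then show ?thesis using step[of j] that s by simp
  qed
  have down: "Bernstein n (Suc j) x \<le> Bernstein n j x" if "s \<le> j" "j < n" for j
  proof -
    have "real n * real s \<le> real n * real j" using that by (intro mult_left_mono) auto
    moreover have "real s \<le> real n" using s by simp
    ultimately have "real s + real n * real s \<le> real n + real n * real j" by linarith
    then have "real (Suc j) * (real n - real s) \<ge> real (n - j) * real s"
      using that s by (simp add: of_nat_diff algebra_simps)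
    then have "Bernstein n j x * (real (Suc j) * (real n - real s)) \<ge> Bernstein n j x * (real (n - j) * real s)"
      using nn by (intro mult_left_mono)
    then have "Bernstein n (Suc j) x * (real (Suc j) * (real n - real s))
        \<le> Bernstein n j x * (real (Suc j) * (real n - real s))" using step[of j] that by simp
    moreover have "real (Suc j) * (real n - real s) > 0" using s by (intro mult_pos_pos) auto
    ultimately show ?thesis by (simp only: mult_le_cancel_right_pos)
  qed
  have "Bernstein n k x \<le> Bernstein n s x"
  proof (cases "k \<le> s")
    case True
    then show ?thesis by (induction rule: inc_induct) (auto intro: order_trans up)
  next
    case False
    then have "s \<le> k" by simp
    then show ?thesis using k
      by (induction rule: dec_induct) (auto intro: order_trans[OF down])
  qed
  then show ?thesis unfolding x_def .
qed

lemma Bernstein_variance: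
  "(\<Sum>k\<le>n. (real k - real n * x)\<^sup>2 * Bernstein n k x) = real n * x * (1 - x)"
proof -
  have "(\<Sum>k\<le>n. (real k - real n * x)\<^sup>2 * Bernstein n k x)
      = (\<Sum>k\<le>n. real k * (real k - 1) * Bernstein n k x) + (1 - 2 * (real n * x)) * (\<Sum>k\<le>n. real k * Bernstein n k x)
        + (real n * x)\<^sup>2 * (\<Sum>k\<le>n. Bernstein n k x)"
    unfolding sum_distrib_left sum.distrib[symmetric]
    by (intro sum.cong) (auto simp: power2_eq_square algebra_simps)
  also have "\<dots> = real n * x * (1 - x)"
    unfolding sum_kk_Bernstein sum_k_Bernstein sum_Bernstein by (simp add: power2_eq_square algebra_simps)
  finally show ?thesis .
qed

text \<open>Chebyshev: at most a quarter of the mass lies outside an interval with \<open>5 * sqrt s\<close> points.\<close>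

lemma Bernstein_mode_lower_bound:
  assumes s: "0 < s" "s < n"
  shows "3 / 20 \<le> sqrt s * Bernstein n s (s / n)"
proof -
  define x where "x = real s / real n"
  have x: "0 < x" "x < 1" unfolding x_def using s by auto
  have nx: "real n * x = s" unfolding x_def using s by simp
  \<comment> \<open>The radius of a window about \<open>s\<close>: a point outside is at distance at
    least \<open>d + 1 > 2 * sqrt s\<close>, so Chebyshev's factor
    \<open>(k - s)^2 / (4 * s)\<close> is at least 1 there.\<close>
  define d where "d = nat \<lfloor>2 * sqrt s\<rfloor>"
  have d: "real d \<le> 2 * sqrt s" "2 * sqrt s < real d + 1"
    unfolding d_def by (simp_all add: of_nat_nat)
  define J where "J = {s - d..s + d}"
  have B: "Bernstein n k x \<ge> 0" for k using Bernstein_nonneg[of x] x by simp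
  have pt: "Bernstein n k x \<le> (real k - real s)\<^sup>2 * Bernstein n k x / (4 * s) + (if k \<in> J then Bernstein n s x else 0)"
    if "k \<le> n" for k
  proof (cases "k \<in> J")
    case True
    have "Bernstein n k x \<le> Bernstein n s x" unfolding x_def by (rule Bernstein_mode[OF s that])
    then show ?thesis using True B[of k] by (simp add: add_increasing)
  next
    case False
    then have "\<bar>real k - real s\<bar> \<ge> real d + 1" unfolding J_def by auto
    then have "2 * sqrt s \<le> \<bar>real k - real s\<bar>" using d by linarith
    then have "(2 * sqrt s)\<^sup>2 \<le> \<bar>real k - real s\<bar>\<^sup>2" by (intro power_mono) auto
    then have "4 * s \<le> (real k - real s)\<^sup>2" by (simp add: power_mult_distrib)
    then have "Bernstein n k x * (4 * s) \<le> Bernstein n k x * (real k - real s)\<^sup>2" using B by (intro mult_left_mono)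
    then show ?thesis using False s by (simp add: field_simps)
  qed
  have "1 = (\<Sum>k\<le>n. Bernstein n k x)" by simp
  also have "\<dots> \<le> (\<Sum>k\<le>n. (real k - real s)\<^sup>2 * Bernstein n k x / (4 * s) + (if k \<in> J then Bernstein n s x else 0))"
    using pt by (intro sum_mono) auto
  also have "\<dots> = (\<Sum>k\<le>n. (real k - real n * x)\<^sup>2 * Bernstein n k x) / (4 * s) + (\<Sum>k\<in>{..n} \<inter> J. Bernstein n s x)"
    unfolding sum.distrib sum_divide_distrib nx by (simp only: sum.inter_restrict[OF finite_atMost])
  also have "\<dots> \<le> 1 / 4 + real (card J) * Bernstein n s x"
  proof (intro add_mono)
    \<comment> \<open>The variance is \<open>s * (1 - x) \<le> s\<close>.\<close>
    show "(\<Sum>k\<le>n. (real k - real n * x)\<^sup>2 * Bernstein n k x) / (4 * s) \<le> 1 / 4"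
      unfolding Bernstein_variance unfolding nx using s x by (simp add: field_simps)
    have "card ({..n} \<inter> J) \<le> card J" by (intro card_mono) (auto simp: J_def)
    then show "(\<Sum>k\<in>{..n} \<inter> J. Bernstein n s x) \<le> real (card J) * Bernstein n s x"
      using B[of s] by (simp add: mult_right_mono)
  qed
  also have "real (card J) * Bernstein n s x \<le> 5 * sqrt s * Bernstein n s x"
  proof (rule mult_right_mono)
    \<comment> \<open>Needed for
      \<open>2 * d + 1 \<le> 4 * sqrt s + 1 \<le> 5 * sqrt s\<close>.\<close>
    have "sqrt s \<ge> 1" using s by simp
    moreover have "card J \<le> 2 * d + 1" unfolding J_def by simp
    then have "real (card J) \<le> 2 * real d + 1" by linarith
    ultimately show "real (card J) \<le> 5 * sqrt s" using d by linarith
  qed (rule B)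
  \<comment> \<open>The constant is \<open>(1 - 1 / 4) / 5 = 3 / 20\<close>.\<close>
  finally show ?thesis unfolding x_def by simp
qed

section \<open>Moment ratios\<close>

text \<open>For the \<open>w\<close> belonging to the saddle point, the hypercontractive constant
  \<open>K ^ n\<close> is exactly \<open>2 powr (psi p x * n)\<close> times
  \<open>(w ^ s) powr p\<close>, and the latter factor cancels.\<close>

lemma homogeneous_poly_moment_bound:
  assumes p: "p \<ge> 2" and s: "real s \<le> real n / 2" and f: "homogeneous_poly n s f"
  shows "cube_expectation n (\<lambda>x. \<bar>f x\<bar> powr p)
    \<le> 2 powr (psi p (real s / real n) * real n) * cube_expectation n (\<lambda>x. (f x)\<^sup>2) powr (p / 2)"
proof (cases "s = 0")
  case True
  \<comment> \<open>For \<open>s = 0\<close> take \<open>w = 0\<close> and \<open>K = 1\<close>;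
    then \<open>w ^ s = 0 ^ 0 = 1\<close>.\<close>
  have "\<bar>a + 0 * b\<bar> powr p + \<bar>a - 0 * b\<bar> powr p \<le> 2 * 1 * (a\<^sup>2 + b\<^sup>2) powr (p / 2)" for a b
    using powr_mono2[of "p / 2" "a\<^sup>2" "a\<^sup>2 + b\<^sup>2"] p by (simp add: square_powr_half)
  from homogeneous_poly_hypercontractive[OF p _ _ f this] True show ?thesis
    using psi_0[OF p] by simp
next
  case False
  define x where "x = real s / real n"
  obtain z where z: "0 < z" "z \<le> 1" "x = saddle_x p z"
    and psi: "2 powr (psi p x * n) = (psum p z / 2) ^ n * z powr (- (p * s)) * (x ^ s * (1 - x) ^ (n - s)) powr (p / 2)"
    using two_powr_psi[OF p _ s] False unfolding x_def by auto
  have S: "psum (p - 1) z > 0" and P: "psum p z > 0" and N: "pdiff (p - 1) z > 0"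
    using z p by (auto intro: psum_pos pdiff_pos)
  have x0: "x > 0" "1 - x > 0"
    using z one_minus_saddle_x[of z p] S P N unfolding saddle_x_def by auto
  have sn: "s \<le> n" using s by simp
  \<comment> \<open>The solution of the criticality condition \<open>wz\<close> in
    \<open>two_point_hypercontractive\<close>.\<close>
  define w where "w = sqrt (z * psum (p - 1) z / pdiff (p - 1) z)"
  have w2: "w\<^sup>2 = z * psum (p - 1) z / pdiff (p - 1) z" and w0: "w > 0"
    unfolding w_def using z S N by auto
  have w2x: "w\<^sup>2 = z\<^sup>2 * ((1 - x) / x)"
    using one_minus_saddle_x[of z p] z S N P unfolding w2
    by (simp add: saddle_x_def power2_eq_square)
  have wx: "w\<^sup>2 / (w\<^sup>2 + z\<^sup>2) = 1 - x"
    unfolding w2x using x0 z by (simp add: field_simps)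
  define K where "K = psum p z / 2 * (1 - x) powr (p / 2)"
  have "\<bar>a + w * b\<bar> powr p + \<bar>a - w * b\<bar> powr p \<le> 2 * K * (a\<^sup>2 + b\<^sup>2) powr (p / 2)" for a b
    using two_point_hypercontractive[OF p z(1,2) w0, of a b] w2 N unfolding wx K_def by simp
  from homogeneous_poly_hypercontractive[OF p _ _ f this]
  have main: "(w ^ s) powr p * cube_expectation n (\<lambda>x. \<bar>f x\<bar> powr p)
      \<le> K ^ n * cube_expectation n (\<lambda>x. (f x)\<^sup>2) powr (p / 2)"
    using P w0 unfolding K_def by simp
  have "(w ^ s) powr p = ((w\<^sup>2) ^ s) powr (p / 2)"
    using w0 square_powr_half[of "w ^ s" p] by (simp add: power_mult[symmetric] mult.commute)
  also have "\<dots> = ((z ^ s)\<^sup>2) powr (p / 2) * (((1 - x) / x) ^ s) powr (p / 2)"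
    unfolding w2x power_mult_distrib powr_mult by (simp add: power_mult[symmetric] mult.commute)
  also have "((z ^ s)\<^sup>2) powr (p / 2) = z powr (p * s)"
    using z square_powr_half[of "z ^ s" p] by (simp add: powr_powr mult.commute flip: powr_realpow)
  finally have wp: "(w ^ s) powr p = z powr (p * s) * (((1 - x) / x) ^ s) powr (p / 2)" .
  have split: "(x ^ s * (1 - x) ^ (n - s)) * ((1 - x) / x) ^ s = (1 - x) ^ n"
  proof -
    have "x ^ s * ((1 - x) / x) ^ s = (1 - x) ^ s" using x0 by (simp flip: power_mult_distrib)
    then have "(x ^ s * (1 - x) ^ (n - s)) * ((1 - x) / x) ^ s = (1 - x) ^ s * (1 - x) ^ (n - s)"
      by (simp add: mult_ac)
    then show ?thesis using sn by (simp flip: power_add)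
  qed
  have "2 powr (psi p x * n) * (w ^ s) powr p
      = (psum p z / 2) ^ n * (z powr (- (p * s)) * z powr (p * s))
        * ((x ^ s * (1 - x) ^ (n - s)) powr (p / 2) * (((1 - x) / x) ^ s) powr (p / 2))"
    unfolding psi wp by (simp only: mult_ac)
  also have "z powr (- (p * s)) * z powr (p * s) = 1" using z by (simp flip: powr_add)
  also have "(x ^ s * (1 - x) ^ (n - s)) powr (p / 2) * (((1 - x) / x) ^ s) powr (p / 2) = ((1 - x) ^ n) powr (p / 2)"
    unfolding split[symmetric] using x0 by (simp only: powr_mult)
  also have "(psum p z / 2) ^ n * 1 * ((1 - x) ^ n) powr (p / 2) = K ^ n"
    unfolding K_def power_mult_distrib using x0
    by (simp add: powr_powr mult.commute flip: powr_realpow)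
  finally have "K ^ n = 2 powr (psi p x * n) * (w ^ s) powr p" ..
  with main have "(w ^ s) powr p * cube_expectation n (\<lambda>x. \<bar>f x\<bar> powr p)
      \<le> (w ^ s) powr p * (2 powr (psi p x * n) * cube_expectation n (\<lambda>x. (f x)\<^sup>2) powr (p / 2))"
    by (simp only: mult_ac)
  moreover have "(w ^ s) powr p > 0" using w0 by simp
  ultimately show ?thesis unfolding x_def by (simp only: mult_le_cancel_left_pos)
qed

text \<open>The test function \<open>gen n z y powr (p - 1)\<close> is proportional to
  \<open>gen n u y\<close>, so its correlation with the Krawchouk polynomial is explicit. The
  relation \<open>z * u * (1 - x) = x\<close> turns it into a binomial probability.\<close>

lemma krawchouk_moment_lower_bound:
  assumes p: "p \<ge> 2" and s: "1 \<le> s" "s \<le> n" and z: "0 < z" "z \<le> 1"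
  defines "x \<equiv> saddle_x p z"
  shows "(psum p z / 2) ^ n * z powr (- (p * s)) * (Bernstein n s x) powr p
    \<le> cube_expectation n (\<lambda>x. \<bar>krawchouk n s x\<bar> powr p)"
proof -
  define S N where "S = psum (p - 1) z" and "N = pdiff (p - 1) z"
  have S: "S > 0" and P: "psum p z > 0" and N: "N > 0"
    unfolding S_def N_def using z p by (auto intro: psum_pos pdiff_pos)
  define u where "u = N / S"
  have x: "1 - x = S / psum p z" "x = z * N / psum p z"
    using one_minus_saddle_x[of z p] z unfolding x_def S_def N_def saddle_x_def by auto
  have x0: "x > 0" "1 - x > 0" using x S P N z by auto
  \<comment> \<open>The correlation divided by the p-th moment of \<open>gen n z\<close>, as
    \<open>moment_lower_bound\<close> requires.\<close>
  define m where "m = real (n choose s) * u ^ s * (1 - x) ^ n"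
  have m0: "m > 0" unfolding m_def u_def using S N x0 s by simp
  have zm: "m = Bernstein n s x / z ^ s"
  proof -
    have "z * u * (1 - x) = x" unfolding x(1) unfolding x(2) u_def using S P by simp
    then have "x ^ s * (1 - x) ^ (n - s) = z ^ s * u ^ s * ((1 - x) ^ s * (1 - x) ^ (n - s))"
      by (metis power_mult_distrib mult.assoc)
    then have "x ^ s * (1 - x) ^ (n - s) = z ^ s * (u ^ s * (1 - x) ^ n)"
      using s by (simp flip: power_add)
    then show ?thesis unfolding m_def Bernstein_def using z by (simp add: mult.assoc)
  qed
  have "S / 2 * (1 + u) = (S + N) / 2" "S / 2 * (1 - u) = (S - N) / 2"
    unfolding u_def using S by (simp_all add: field_simps)
  then have "S / 2 * (1 + u) = (1 + z) powr (p - 1)" "S / 2 * (1 - u) = (1 - z) powr (p - 1)"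
    unfolding S_def N_def psum_def pdiff_def by simp_all
  then have gp: "gen n z y powr (p - 1) = (S / 2) ^ n * gen n u y" for y
    using z by (intro gen_powr) auto
  have sum_g: "(\<Sum>y\<in>cube n. gen n z y powr p) = psum p z ^ n"
    using gen_moment[of z n p] z unfolding cube_expectation_eq psum_def by (simp add: power_divide)
  have "(\<Sum>y\<in>cube n. krawchouk n s y * gen n z y powr (p - 1))
      = (S / 2) ^ n * (\<Sum>y\<in>cube n. krawchouk n s y * gen n u y)"
    unfolding gp sum_distrib_left by (intro sum.cong) auto
  also have "\<dots> = S ^ n * (real (n choose s) * u ^ s)"
    using krawchouk_gen_correlation[of n s u] unfolding cube_expectation_eq by (simp add: field_simps power_divide)
  also have "\<dots> = m * psum p z ^ n"
    unfolding m_def x(1) using P by (simp add: power_divide)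
  finally have "(\<Sum>y\<in>cube n. krawchouk n s y * gen n z y powr (p - 1)) = m * (\<Sum>y\<in>cube n. gen n z y powr p)"
    unfolding sum_g .
  then have "m powr p * psum p z ^ n \<le> (\<Sum>y\<in>cube n. \<bar>krawchouk n s y\<bar> powr p)"
    using moment_lower_bound[of p m "cube n" "gen n z" "krawchouk n s"] p m0 z gen_nonneg[of z n]
    unfolding sum_g by auto
  then have "(psum p z / 2) ^ n * m powr p \<le> cube_expectation n (\<lambda>x. \<bar>krawchouk n s x\<bar> powr p)"
    unfolding cube_expectation_eq by (simp add: power_divide field_simps)
  also have "m powr p = z powr (- (p * s)) * Bernstein n s x powr p"
  proof -
    have "(z ^ s) powr p = z powr (p * s)"
      using z by (simp add: powr_powr mult.commute flip: powr_realpow)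
    then show ?thesis unfolding zm by (simp add: powr_divide powr_minus_divide)
  qed
  finally show ?thesis by (simp add: mult.assoc)
qed

text \<open>With the binomial probability \<open>\<beta>\<close> and the second moment
  \<open>c\<close>, the left-hand side is \<open>W * \<beta> powr (p / 2) / c powr (p / 2)\<close>,
  while testing gives the moment at least \<open>W * \<beta> powr p\<close>. The gap
  \<open>(1 / \<beta>) powr (p / 2)\<close> is controlled by
  \<open>Bernstein_mode_lower_bound\<close>.\<close>

lemma krawchouk_nearly_extremal:
  assumes p: "p \<ge> 2" and s: "1 \<le> s" "real s \<le> real n / 2"
  shows "2 powr (psi p (real s / real n) * real n)
    \<le> 7 powr p * real s powr (p / 4)
      * (cube_expectation n (\<lambda>x. \<bar>krawchouk n s x\<bar> powr p)
         / (cube_expectation n (\<lambda>x. (krawchouk n s x)\<^sup>2)) powr (p / 2))"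
proof -
  define x where "x = real s / real n"
  obtain z where z: "0 < z" "z \<le> 1" "x = saddle_x p z"
    and psi: "2 powr (psi p x * n) = (psum p z / 2) ^ n * z powr (- (p * s)) * (x ^ s * (1 - x) ^ (n - s)) powr (p / 2)"
    using two_powr_psi[OF p s] unfolding x_def by auto
  have sn: "0 < s" "s < n" "s \<le> n" using s by auto
  have x: "0 < x" "x < 1" unfolding x_def using sn by auto
  define c where "c = real (n choose s)"
  define \<beta> where "\<beta> = Bernstein n s x"
  define M where "M = cube_expectation n (\<lambda>x. \<bar>krawchouk n s x\<bar> powr p)"
  define W where "W = (psum p z / 2) ^ n * z powr (- (p * s))"
  have c0: "c > 0" unfolding c_def using sn by simp
  have \<beta>0: "\<beta> > 0" unfolding \<beta>_def using x sn by (intro Bernstein_pos) auto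
  have W: "W * \<beta> powr p \<le> M"
    using krawchouk_moment_lower_bound[OF p s(1) sn(3) z(1,2)] z(3) unfolding W_def \<beta>_def M_def by simp
  \<comment> \<open>The constant \<open>20 / 3\<close> is rounded up to 7.\<close>
  have lower: "1 / \<beta> \<le> 7 * sqrt s"
    using Bernstein_mode_lower_bound[OF sn(1,2)] \<beta>0 unfolding \<beta>_def x_def by (simp add: field_simps)
  have "x ^ s * (1 - x) ^ (n - s) = \<beta> / c"
    unfolding \<beta>_def Bernstein_def c_def using sn by simp
  then have "2 powr (psi p x * n) = W * \<beta> powr (p / 2) / c powr (p / 2)"
    unfolding psi W_def using c0 \<beta>0 by (simp add: powr_divide)
  also have "\<dots> = (W * \<beta> powr p) * (1 / \<beta>) powr (p / 2) / c powr (p / 2)"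
  proof -
    have "\<beta> powr p * (1 / \<beta>) powr (p / 2) = \<beta> powr (p / 2)"
      using \<beta>0 by (simp add: powr_divide powr_diff[symmetric])
    then show ?thesis by (simp add: mult.assoc)
  qed
  also have "\<dots> \<le> M * (7 powr p * real s powr (p / 4)) / c powr (p / 2)"
  proof (intro divide_right_mono mult_mono W)
    have "(1 / \<beta>) powr (p / 2) \<le> (7 * sqrt s) powr (p / 2)"
      using lower p \<beta>0 by (intro powr_mono2) auto
    also have "\<dots> = 7 powr (p / 2) * real s powr (p / 4)"
      using sn by (simp add: powr_mult powr_half_sqrt[symmetric] powr_powr)
    also have "\<dots> \<le> 7 powr p * real s powr (p / 4)"
      using p by (intro mult_right_mono powr_mono) auto
    finally show "(1 / \<beta>) powr (p / 2) \<le> 7 powr p * real s powr (p / 4)" .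
    have "0 \<le> W * \<beta> powr p" unfolding W_def using psum_pos[of z p] z by simp
    then show "0 \<le> M" using W by linarith
  qed auto
  finally show ?thesis
    unfolding krawchouk_second_moment c_def[symmetric] M_def[symmetric] x_def[symmetric] by (simp add: mult_ac)
qed

theorem theorem1p3:
  shows "(\<forall>(n::nat) (p::real) (s::nat) (f :: (nat \<Rightarrow> nat) \<Rightarrow> real).
            n \<ge> 1 \<longrightarrow> p \<ge> 2 \<longrightarrow> real s \<le> real n / 2 \<longrightarrow>
            homogeneous_poly n s f \<longrightarrow> (\<exists>x \<in> cube n. f x \<noteq> 0) \<longrightarrow>
            cube_expectation n (\<lambda>x. \<bar>f x\<bar> powr p)
              / (cube_expectation n (\<lambda>x. (f x)\<^sup>2)) powr (p / 2)
            \<le> 2 powr (psi p (real s / real n) * real n))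
       \<and> (\<exists>C::real. C > 0 \<and>
           (\<forall>(n::nat) (p::real) (s::nat).
              n \<ge> 1 \<longrightarrow> p \<ge> 2 \<longrightarrow> 1 \<le> s \<longrightarrow> real s \<le> real n / 2 \<longrightarrow>
              2 powr (psi p (real s / real n) * real n)
              \<le> real n * C powr p * real s powr (p / 4)
                * (cube_expectation n (\<lambda>x. \<bar>krawchouk n s x\<bar> powr p)
                   / (cube_expectation n (\<lambda>x. (krawchouk n s x)\<^sup>2)) powr (p / 2))))"
proof (intro conjI allI impI exI[of _ "7::real"])
  fix n :: nat and p :: real and s :: nat and f :: "(nat \<Rightarrow> nat) \<Rightarrow> real"
  assume "n \<ge> 1" "p \<ge> 2" "real s \<le> real n / 2" "homogeneous_poly n s f"
  from homogeneous_poly_moment_bound[OF this(2-4)]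
  show "cube_expectation n (\<lambda>x. \<bar>f x\<bar> powr p) / (cube_expectation n (\<lambda>x. (f x)\<^sup>2)) powr (p / 2)
      \<le> 2 powr (psi p (real s / real n) * real n)"
    \<comment> \<open>If the denominator is 0, the quotient is 0 by the convention for
      division.\<close>
    by (cases "(cube_expectation n (\<lambda>x. (f x)\<^sup>2)) powr (p / 2) = 0")
       (simp_all add: pos_divide_le_eq order_less_le)
next
  fix n :: nat and p :: real and s :: nat
  assume n: "n \<ge> 1" and ps: "p \<ge> 2" "1 \<le> s" "real s \<le> real n / 2"
  define T where "T = 7 powr p * real s powr (p / 4) * (cube_expectation n (\<lambda>x. \<bar>krawchouk n s x\<bar> powr p)
     / (cube_expectation n (\<lambda>x. (krawchouk n s x)\<^sup>2)) powr (p / 2))"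
  have "2 powr (psi p (real s / real n) * real n) \<le> T"
    using krawchouk_nearly_extremal[OF ps] unfolding T_def .
  moreover from this have "T \<ge> 0" using powr_ge_zero order_trans by blast
  \<comment> \<open>Since \<open>T\<close> is nonnegative, the factor \<open>n \<ge> 1\<close> can
    be inserted.\<close>
  then have "1 * T \<le> real n * T" using n by (intro mult_right_mono) auto
  ultimately show "2 powr (psi p (real s / real n) * real n)
      \<le> real n * 7 powr p * real s powr (p / 4)
        * (cube_expectation n (\<lambda>x. \<bar>krawchouk n s x\<bar> powr p)
           / (cube_expectation n (\<lambda>x. (krawchouk n s x)\<^sup>2)) powr (p / 2))"
    unfolding T_def by (simp add: mult.assoc)
qed simp

end
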